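(* Let $R\ge 1$, $N\ge1$, and let $\mathbb{T}$ be a collection of separated $(R^{2/3},R^{2/3},R)$-Vinogradov tubes in $[-R,R]^3$ satisfying the following condition. (S1) For each $I\in\mathbb{I}_{R^{-1/3}}$, cover $[-R,R]^3$ with $(R^{2/3},R,R)$-plates $S_I$ with normal vector $\mathbf t(I)$, so that each $T\in\mathbb{T}(I)$ sits inside one such plate $S_I$. Each such $S_I$ contains at most $N$ tubes $T\in\mathbb{T}(I)$. For $r\ge1$ let $\mathcal{Q}_r$ be a collection of pairwise disjoint $r$-rich cubes of side length $\sim R^{2/3}$. Then for each $r\ge1$ we have $$|\mathcal{Q}_r|\lessapprox \frac{|\mathbb{T}|\,N\,R^{\frac13}}{r^2}.$$
   Context: Let $\Gamma(t)=(t,t^2,t^3)$, $t\in[0,1]$. $\mathbb{I}_{R^{-1/3}}$ is the partition of $[0,1]$ into intervals of length $R^{-1/3}$. For $I=[c,c+R^{-1/3}]$, $\mathbf{t}(I),\mathbf{n}(I),\mathbf{b}(I)$ denote the unit tangent, normal and binormal vectors (Frenet frame) of $\Gamma$ at $\Gamma(c)$. A Vinogradov tube (at scale $R$) associated with $I=[c,c+R^{-1/3}]$ is a $(R^{2/3},R^{2/3},R)$-tube with long edge in the direction $\mathbf b(I)$; it is essentially a translate of $$\{x\in\mathbb{R}^3:\ |x_1+2cx_2+3c^2x_3|\le R^{2/3},\ |x_2+3cx_3|\le R^{2/3},\ |x_3|\le R\}.$$ $\mathbb{T}(I)$ is the subcollection of tubes in $\mathbb{T}$ associated with $I$. Dimensions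 of boxes are understood up to $O(1)$ multiplicative factors, and boxes $B_1,B_2$ with $C^{-1}B_2\subset B_1\subset CB_2$, $C=O(1)$, are not distinguished. A collection of tubes is separated if, for each $I$, the (mutually parallel) tubes corresponding to $I$ have bounded overlap. A $(R^{2/3},R,R)$-plate with normal $\mathbf t(I)$ is a box with the edge of length $R^{2/3}$ in direction $\mathbf t(I)$ and the other two edges of length $R$. A cube $q$ of side length $\sim R^{2/3}$ is $r$-rich if it intersects at least $r$ tubes $T\in\mathbb{T}$. $X\lessapprox Y$ means $X\le C(\log R)^{C}Y$ for an absolute constant $C$ (for large $R$). *)

theory Defs
  imports "HOL-Analysis.Analysis"
begin

section \<open>The moment curve and its Frenet frame\<close>

definition moment_curve :: "real \<Rightarrow> real^3" where
  "moment_curve t = vector [t, t^2, t^3]"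

definition tangent :: "real \<Rightarrow> real^3" where
  "tangent c = sgn (vector_derivative moment_curve (at c))"

definition normal :: "real \<Rightarrow> real^3" where
  "normal c = sgn (vector_derivative tangent (at c))"

definition binormal :: "real \<Rightarrow> real^3" where
  "binormal c = cross3 (tangent c) (normal c)"

text \<open>
  An interval \<open>I = [c, c + R\<^sup>-\<^sup>1\<^sup>/\<^sup>3]\<close> of the partition of \<open>[0,1]\<close> is represented by its left endpoint
  \<open>c\<close>.  If \<open>R\<^sup>1\<^sup>/\<^sup>3\<close> is not an integer, the last interval reaches beyond \<open>1\<close>.
\<close>

definition partition_points :: "real \<Rightarrow> real set" where
  "partition_points R = {c. 0 \<le> c \<and> c < 1 \<and> (\<exists>k::nat. c = real k * R powr (-1/3))}"


section \<open>Boxes, tubes, plates and cubes\<close>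

text \<open>
  All \<open>O(1)\<close> factors are bounded by a parameter \<open>K \<ge> 1\<close>.  Box means (possibly slanted)
  parallelepiped, as Vinogradov tubes are often described by slanted coordinates.
\<close>

definition box3 :: "(real^3) set \<Rightarrow> bool" where
  "box3 B \<longleftrightarrow> (\<exists>p (f :: real^3 \<Rightarrow> real^3). linear f \<and> inj f \<and> B = (\<lambda>x. p + f x) ` cbox (-1) 1)"

text \<open>The rectangular box with centre \<open>p\<close> and edges of length \<open>l\<^sub>1, l\<^sub>2, l\<^sub>3\<close> in the directions
  of the tangent, normal and binormal vectors.\<close>

definition frenet_box :: "real \<Rightarrow> real^3 \<Rightarrow> real \<Rightarrow> real \<Rightarrow> real \<Rightarrow> (real^3) set" where
  "frenet_box c p l1 l2 l3 =
     {x. \<bar>(x - p) \<bullet> tangent c\<bar> \<le> l1 / 2 \<and> \<bar>(x - p) \<bullet> normal c\<bar> \<le> l2 / 2 \<and>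
         \<bar>(x - p) \<bullet> binormal c\<bar> \<le> l3 / 2}"

text \<open>\<open>K\<^sup>-\<^sup>1 B\<^sub>0 \<subseteq> B \<subseteq> K B\<^sub>0\<close> for some Frenet box \<open>B\<^sub>0\<close> of dimensions \<open>l\<^sub>1, l\<^sub>2, l\<^sub>3\<close>,
  dilations being about the centre of \<open>B\<^sub>0\<close>.\<close>

definition essentially_frenet_box ::
    "real \<Rightarrow> real \<Rightarrow> real \<Rightarrow> real \<Rightarrow> real \<Rightarrow> (real^3) set \<Rightarrow> bool" where
  "essentially_frenet_box K c l1 l2 l3 B \<longleftrightarrow> box3 B \<and>
     (\<exists>p. frenet_box c p (l1 / K) (l2 / K) (l3 / K) \<subseteq> B \<and>
          B \<subseteq> frenet_box c p (K * l1) (K * l2) (K * l3))"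

definition vinogradov_tube :: "real \<Rightarrow> real \<Rightarrow> real \<Rightarrow> (real^3) set \<Rightarrow> bool" where
  "vinogradov_tube K R c T \<longleftrightarrow>
     essentially_frenet_box K c (R powr (2/3)) (R powr (2/3)) R T"

text \<open>Up to \<open>O(1)\<close> factors it does not matter how the two long edges, of equal length, are
  rotated within the plane orthogonal to the tangent vector.\<close>

definition plate :: "real \<Rightarrow> real \<Rightarrow> real \<Rightarrow> (real^3) set \<Rightarrow> bool" where
  "plate K R c S \<longleftrightarrow> essentially_frenet_box K c (R powr (2/3)) R R S"

text \<open>Cubes may have any orientation, and may be open, closed or, like the cells of a grid, contain
  only a part of their boundary.\<close>

definition cube3 :: "real \<Rightarrow> (real^3) set \<Rightarrow> bool" where
  "cube3 s q \<longleftrightarrow> s > 0 \<and> (\<exists>p (f :: real^3 \<Rightarrow> real^3). orthogonal_transformation f \<and>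
     (\<lambda>x. p + f x) ` box 0 (s *\<^sub>R 1) \<subseteq> q \<and> q \<subseteq> (\<lambda>x. p + f x) ` cbox 0 (s *\<^sub>R 1))"

definition big_cube :: "real \<Rightarrow> (real^3) set" where
  "big_cube R = {x. \<forall>i. \<bar>x $ i\<bar> \<le> R}"

definition bounded_overlap :: "real \<Rightarrow> 'a set set \<Rightarrow> bool" where
  "bounded_overlap K \<A> \<longleftrightarrow> (\<forall>x. finite {A \<in> \<A>. x \<in> A} \<and> real (card {A \<in> \<A>. x \<in> A}) \<le> K)"


section \<open>Collections of tubes\<close>

text \<open>
  As tubes are only determined up to \<open>O(1)\<close> factors, one set can be a tube for several neighbouring
  intervals.  A collection of tubes \<open>\<T>\<close> therefore comes with a map \<open>dir\<close> that
  assigns to every tube (the left endpoint of) its interval.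
\<close>

definition tubes_of :: "(real^3) set set \<Rightarrow> ((real^3) set \<Rightarrow> real) \<Rightarrow> real \<Rightarrow> (real^3) set set" where
  "tubes_of \<T> dir c = {T \<in> \<T>. dir T = c}"

definition separated_vinogradov_tubes ::
    "real \<Rightarrow> real \<Rightarrow> (real^3) set set \<Rightarrow> ((real^3) set \<Rightarrow> real) \<Rightarrow> bool" where
  "separated_vinogradov_tubes K R \<T> dir \<longleftrightarrow>
     (\<forall>T\<in>\<T>. dir T \<in> partition_points R \<and> vinogradov_tube K R (dir T) T \<and> T \<subseteq> big_cube R) \<and>
     (\<forall>c\<in>partition_points R. bounded_overlap K (tubes_of \<T> dir c))"

text \<open>
  The plates of a cover are required to have bounded overlap, as is implicit in speaking of a
  cover by plates.  Otherwise the second half of the condition would be void: tubes of one plate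
  that are slightly shifted along their long direction could each be enclosed in a separate,
  correspondingly shifted plate, containing no other tube.
\<close>

definition S1 :: "real \<Rightarrow> real \<Rightarrow> real \<Rightarrow> (real^3) set set \<Rightarrow> ((real^3) set \<Rightarrow> real) \<Rightarrow> bool" where
  "S1 K R N \<T> dir \<longleftrightarrow>
     (\<forall>c\<in>partition_points R. \<exists>\<S>.
        (\<forall>S\<in>\<S>. plate K R c S) \<and> bounded_overlap K \<S> \<and> big_cube R \<subseteq> \<Union>\<S> \<and>
        (\<forall>T\<in>tubes_of \<T> dir c. \<exists>S\<in>\<S>. T \<subseteq> S) \<and>
        (\<forall>S\<in>\<S>. real (card {T \<in> tubes_of \<T> dir c. T \<subseteq> S}) \<le> N))"

definition rich :: "real \<Rightarrow> (real^3) set set \<Rightarrow> (real^3) set \<Rightarrow> bool" where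
  "rich r \<T> q \<longleftrightarrow> real (card {T \<in> \<T>. q \<inter> T \<noteq> {}}) \<ge> r"

definition rich_cubes :: "real \<Rightarrow> real \<Rightarrow> real \<Rightarrow> (real^3) set set \<Rightarrow> (real^3) set set \<Rightarrow> bool" where
  "rich_cubes K R r \<T> \<Q> \<longleftrightarrow> pairwise disjnt \<Q> \<and>
     (\<forall>q\<in>\<Q>. rich r \<T> q \<and> (\<exists>s. R powr (2/3) / K \<le> s \<and> s \<le> K * R powr (2/3) \<and> cube3 s q))"

end

theory Submission
  imports Defs "HOL-Probability.Characteristic_Functions"
begin

text \<open>
  After rescaling by \<open>R\<^sup>2\<^sup>/\<^sup>3\<close>, with \<open>d = R\<^sup>-\<^sup>1\<^sup>/\<^sup>3\<close>, tubes are \<open>1 \<times> 1 \<times> 1/d\<close> and cubes are points.  Replace each tube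
  by a Gaussian.  Its Fourier transform is a Gaussian \<open>exp (- q/2)\<close> concentrated on a slab through the
  origin, which depends only on the direction \<open>c\<close>, times a wave.  Telescope it over dyadic
  scales \<open>s = 2\<^sup>j d\<close>: the \<open>j\<close>-th difference lives on the frequency box common to all slabs with directions in
  the dyadic arc of length \<open>s\<close> around \<open>c\<close>, minus the box of the next scale.  Because \<open>c \<mapsto> \<xi> \<bullet> b(c)\<close> is, up to a
  factor, a quadratic polynomial, each frequency \<open>\<xi>\<close> meets boundedly many of these differences, so
  the arcs of one scale are almost orthogonal.  For a single arc one counts pairs of tubes in the dual box
  (of size \<open>1 + s\<^sup>2/d\<close> by \<open>s/d\<close> by \<open>1/d\<close>), and for each of the \<open>s/d\<close> directions the plates of
  condition (S1) give at most about \<open>N (1 + s\<^sup>2/d)\<close> tubes.  Every scale contributes the same amount, which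
  costs only logarithms.  No Plancherel theorem is required: the incidences are paired with
  exponential sums over the cube centres, and all integrals are explicit Gaussian integrals.
\<close>

text \<open>All slabs share a neighbourhood of the origin, so without subtracting the coarser boxes
  a frequency there would be counted once per direction. Gaussians have full support, hence
  "boundedly many" cannot be literal: it becomes a bound on a sum of weights, uniform in \<xi> and
  in the scale. The weights arise as follows. In units of the box of an arc a frequency has three
  coordinates \<open>a\<close>, \<open>b\<close>, \<open>k\<close>; here \<open>a\<close> is the
  same for all arcs of a scale, \<open>b\<close> moves by \<open>-2 a\<close> from one arc to the
  next and \<open>k\<close> by \<open>3 a - 3 b\<close>. The quadratic forms of a box and of its
  parent differ by terms that all contain \<open>a\<close> or \<open>b\<close>, so a difference of
  Gaussians is dominated by the sizes of these steps times a power of the form. Summing the steps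
  along the arcs, damped by \<open>1 / (1 + b^2)\<close> and \<open>1 / (1 + k^2)\<close>, gives the
  total variation of \<open>arctan\<close> along a linear and a quadratic sequence. The powers are
  paid for with part of the decay: the exponent drops from \<open>q / 2\<close> to
  \<open>q / 80\<close>.\<close>

section \<open>Gaussian Fourier integrals in slanted coordinates\<close>

text \<open>Translation invariance of the inner integral. Since \<open>\<phi>\<close> depends on the
  other variable only, two applications pass from the standard coordinates of a frequency to the
  slanted ones without a change of variables in three dimensions.\<close>

lemma integral_shear:
  fixes f :: "'a::euclidean_space \<Rightarrow> complex" and h :: "real \<Rightarrow> complex" and \<phi> :: "'a \<Rightarrow> real"
  assumes f: "integrable lborel f" and h: "integrable lborel h" and \<phi>[measurable]: "\<phi> \<in> borel_measurable borel"
  shows "integrable lborel (\<lambda>x. f (fst x) * h (snd x - \<phi> (fst x)))" (is "integrable _ ?F")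
    and "(\<integral>x. f (fst x) * h (snd x - \<phi> (fst x)) \<partial>lborel) = (\<integral>x. f x \<partial>lborel) * (\<integral>x. h x \<partial>lborel)"
proof -
  have [measurable]: "f \<in> borel_measurable borel" "h \<in> borel_measurable borel"
    using f h by auto
  have hs: "integrable lborel (\<lambda>y. h (y - t))" "(\<integral>y. h (y - t) \<partial>lborel) = (\<integral>x. h x \<partial>lborel)" for t
    using lborel_integrable_real_affine[OF h, of 1 "-t"] lborel_integral_real_affine[of 1 h "-t"]
    by (simp_all add: algebra_simps)
  have hn: "(\<integral>y. norm (h (y - t)) \<partial>lborel) = (\<integral>x. norm (h x) \<partial>lborel)" for t
    using lborel_integral_real_affine[of 1 "\<lambda>x. norm (h x)" "-t"] by (simp add: algebra_simps)
  have I: "integrable (lborel \<Otimes>\<^sub>M lborel) ?F"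
    using f hs(1) by (intro lborel_pair.Fubini_integrable) (auto simp: norm_mult hn)
  then show "integrable lborel ?F" by (simp add: lborel_prod)
  have "(\<integral>x. ?F x \<partial>lborel) = (\<integral>x. ?F x \<partial>(lborel \<Otimes>\<^sub>M lborel))" by (simp add: lborel_prod)
  also have "\<dots> = (\<integral>x. (\<integral>y. ?F (x, y) \<partial>lborel) \<partial>lborel)"
    by (rule lborel_pair.integral_fst'[symmetric, OF I])
  finally show "(\<integral>x. ?F x \<partial>lborel) = (\<integral>x. f x \<partial>lborel) * (\<integral>x. h x \<partial>lborel)"
    by (simp add: hs)
qed

text \<open>For \<open>p = 1\<close> this is the characteristic function of the standard normal
  distribution; substituting \<open>sqrt p * z\<close> gives the rest.\<close>

lemma fourier_gaussian:
  fixes p u :: real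
  assumes "p > 0"
  shows "integrable lborel (\<lambda>z. of_real (exp (- (p * z\<^sup>2 / 2))) * cis (z * u))"
    and "(\<integral>z. of_real (exp (- (p * z\<^sup>2 / 2))) * cis (z * u) \<partial>lborel) =
      of_real (sqrt (2 * pi / p) * exp (- (u\<^sup>2 / p / 2)))"
proof -
  define g where "g t z = (of_real (exp (- (z\<^sup>2 / 2))) * cis (z * t) :: complex)" for t z
  have gi: "integrable lborel (g t)" for t
  proof -
    have "integrable lborel (\<lambda>z. sqrt (2 * pi) * std_normal_density z)" by simp
    then have 1: "integrable lborel (\<lambda>z. exp (- (z\<^sup>2 / 2)) :: real)"
      by (simp add: normal_density_def)
    show ?thesis
    proof (rule Bochner_Integration.integrable_bound[OF 1])
      have "g t \<in> borel_measurable borel"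
        unfolding g_def by (intro borel_measurable_continuous_onI continuous_intros) auto
      then show "g t \<in> borel_measurable lborel" by simp
    qed (simp add: g_def norm_mult)
  qed
  have gv: "(\<integral>z. g t z \<partial>lborel) = of_real (sqrt (2 * pi) * exp (- (t\<^sup>2 / 2)))" for t
  proof -
    have "of_real (exp (- (t^2) / 2)) = (CLINT x|std_normal_distribution. iexp (t * x))"
      using char_std_normal_distribution by (metis char_def)
    also have "\<dots> = (\<integral>x. std_normal_density x *\<^sub>R iexp (t * x) \<partial>lborel)"
      by (intro integral_density) (auto simp: normal_density_nonneg)
    also have "\<dots> = (\<integral>x. of_real (1 / sqrt (2 * pi)) * g t x \<partial>lborel)"
      by (intro Bochner_Integration.integral_cong)
        (auto simp: g_def cis_conv_exp normal_density_def scaleR_conv_of_real ac_simps)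
    also have "\<dots> = of_real (1 / sqrt (2 * pi)) * (\<integral>x. g t x \<partial>lborel)" by simp
    finally have "(\<integral>x. g t x \<partial>lborel) = of_real (sqrt (2 * pi)) * of_real (exp (- (t^2) / 2))"
      by (simp add: field_simps)
    then show ?thesis by simp
  qed
  define t where "t = u / sqrt p"
  have e: "of_real (exp (- (p * z\<^sup>2 / 2))) * cis (z * u) = g t (0 + sqrt p * z)" for z
    using assms by (simp add: g_def t_def power_mult_distrib field_simps)
  show "integrable lborel (\<lambda>z. of_real (exp (- (p * z\<^sup>2 / 2))) * cis (z * u))"
    unfolding e using assms by (intro lborel_integrable_real_affine gi) auto
  have "(\<integral>z. g t z \<partial>lborel) = \<bar>sqrt p\<bar> *\<^sub>R (\<integral>z. g t (0 + sqrt p * z) \<partial>lborel)"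
    using assms by (intro lborel_integral_real_affine) auto
  then have "(\<integral>z. g t (0 + sqrt p * z) \<partial>lborel) = of_real (sqrt (2 * pi) * exp (- (t\<^sup>2 / 2)) / sqrt p)"
    using assms by (simp add: gv scaleR_conv_of_real field_simps)
  then show "(\<integral>z. of_real (exp (- (p * z\<^sup>2 / 2))) * cis (z * u) \<partial>lborel) =
      of_real (sqrt (2 * pi / p) * exp (- (u\<^sup>2 / p / 2)))"
    unfolding e using assms by (simp add: t_def power_divide real_sqrt_divide)
qed

text \<open>Up to scalar factors, \<open>ucoord c x\<close> and \<open>vcoord c x\<close> are the pairings of \<open>x\<close> with the first two derivatives of the
  moment curve; \<open>fbeta\<close> and \<open>fkappa\<close> are the coordinates of a frequency in the dual basis, so that the
  frequency \<open>\<xi>\<close> lies in the slab of direction \<open>c\<close> if \<open>fkappa c \<xi>\<close> is small.\<close>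

definition ucoord :: "real \<Rightarrow> real^3 \<Rightarrow> real" where
  "ucoord c x = x $ 1 + 2 * c * x $ 2 + 3 * c\<^sup>2 * x $ 3"

definition vcoord :: "real \<Rightarrow> real^3 \<Rightarrow> real" where
  "vcoord c x = x $ 2 + 3 * c * x $ 3"

text \<open>Frequencies are nested pairs and not vectors, so that \<open>lborel\<close> splits as a
  product and \<open>integral_shear\<close> can treat one coordinate at a time.\<close>

definition phase :: "real^3 \<Rightarrow> (real \<times> real) \<times> real \<Rightarrow> real" where
  "phase x \<xi> = fst (fst \<xi>) * x $ 1 + snd (fst \<xi>) * x $ 2 + snd \<xi> * x $ 3"

definition fbeta :: "real \<Rightarrow> (real \<times> real) \<times> real \<Rightarrow> real" where
  "fbeta c \<xi> = snd (fst \<xi>) - 2 * c * fst (fst \<xi>)"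

definition fkappa :: "real \<Rightarrow> (real \<times> real) \<times> real \<Rightarrow> real" where
  "fkappa c \<xi> = snd \<xi> - (3 * c * snd (fst \<xi>) - 3 * c\<^sup>2 * fst (fst \<xi>))"

definition aniso :: "real \<Rightarrow> real \<Rightarrow> real \<Rightarrow> real \<Rightarrow> (real \<times> real) \<times> real \<Rightarrow> real" where
  "aniso c p q s \<xi> = p * (fst (fst \<xi>))\<^sup>2 + q * (fbeta c \<xi>)\<^sup>2 + s * (fkappa c \<xi>)\<^sup>2"

lemma phase_frame:
  "phase x \<xi> = fst (fst \<xi>) * ucoord c x + fbeta c \<xi> * vcoord c x + fkappa c \<xi> * x $ 3"
  by (simp add: phase_def ucoord_def vcoord_def fbeta_def fkappa_def power2_eq_square algebra_simps)

lemma fourier_aniso: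
  assumes "p > 0" "q > 0" "s > 0"
  shows "integrable lborel (\<lambda>\<xi>. of_real (exp (- (aniso c p q s \<xi> / 2))) * cis (phase x \<xi>))" (is ?A)
    and "(\<integral>\<xi>. of_real (exp (- (aniso c p q s \<xi> / 2))) * cis (phase x \<xi>) \<partial>lborel) =
      of_real (sqrt (2 * pi / p) * sqrt (2 * pi / q) * sqrt (2 * pi / s) *
         exp (- (((ucoord c x)\<^sup>2 / p + (vcoord c x)\<^sup>2 / q + (x $ 3)\<^sup>2 / s) / 2)))" (is ?B)
proof -
  define h where "h p u z = (of_real (exp (- (p * z\<^sup>2 / 2))) * cis (z * u) :: complex)" for p u z :: real
  define f where "f y = h p (ucoord c x) (fst y) * h q (vcoord c x) (snd y - 2 * c * fst y)" for y
  define \<phi> where "\<phi> y = 3 * c * snd y - 3 * c\<^sup>2 * fst y" for y :: "real \<times> real"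
  have [measurable]: "\<phi> \<in> borel_measurable borel"
    by (simp add: \<phi>_def borel_measurable_continuous_onI continuous_intros)
  note h = fourier_gaussian[folded h_def]
  note F = integral_shear[OF h(1)[OF assms(1), of "ucoord c x"] h(1)[OF assms(2), of "vcoord c x"],
      of "\<lambda>y. 2 * c * y", simplified, folded f_def]
  note G = integral_shear[OF F(1) h(1)[OF assms(3), of "x $ 3"], of \<phi>, simplified]
  have E: "of_real (exp (- (aniso c p q s \<xi> / 2))) * cis (phase x \<xi>) =
     f (fst \<xi>) * h s (x $ 3) (snd \<xi> - \<phi> (fst \<xi>))" for \<xi>
  proof -
    have "of_real (exp (- (aniso c p q s \<xi> / 2))) = (of_real (exp (- (p * (fst (fst \<xi>))\<^sup>2 / 2))) *
      of_real (exp (- (q * (fbeta c \<xi>)\<^sup>2 / 2))) * of_real (exp (- (s * (fkappa c \<xi>)\<^sup>2 / 2))) :: complex)"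
      unfolding of_real_mult[symmetric] exp_add[symmetric] aniso_def by (simp add: field_simps)
    then show ?thesis
      unfolding phase_frame[of x \<xi> c] cis_mult[symmetric]
      by (simp add: f_def h_def fbeta_def fkappa_def \<phi>_def mult_ac)
  qed
  show ?A unfolding E by (rule G(1))
  have X: "exp (- (((ucoord c x)\<^sup>2 / p + (vcoord c x)\<^sup>2 / q + (x $ 3)\<^sup>2 / s) / 2)) =
      exp (- ((ucoord c x)\<^sup>2 / p / 2)) * exp (- ((vcoord c x)\<^sup>2 / q / 2)) * exp (- ((x $ 3)\<^sup>2 / s / 2))"
    unfolding exp_add[symmetric] by (simp add: field_simps)
  show ?B unfolding E G(2) F(2) h(2)[OF assms(1)] h(2)[OF assms(2)] h(2)[OF assms(3)] X
      of_real_mult by (simp only: mult_ac)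
qed

section \<open>Sums along quadratic sequences\<close>

text \<open>Mean value theorem: an intermediate point \<open>w\<close> lies within
  \<open>\<bar>d\<bar>\<close> of \<open>x\<close>, so
  \<open>1 + w^2 <= 2 (1 + x^2) (1 + d^2)\<close>. The factor \<open>1 + d^2\<close> keeps the bound
  valid for long steps.\<close>

lemma arctan_diff_ge:
  fixes x d :: real
  shows "\<bar>d\<bar> / ((1 + x\<^sup>2) * (1 + d\<^sup>2)) \<le> 2 * \<bar>arctan (x + d) - arctan x\<bar>"
proof -
  have *: "(y - z) / ((1 + x\<^sup>2) * (1 + d\<^sup>2)) \<le> 2 * (arctan y - arctan z)"
    if "z < y" and lim: "\<And>w. z < w \<Longrightarrow> w < y \<Longrightarrow> (w - x)\<^sup>2 \<le> d\<^sup>2" for y z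
  proof -
    obtain w where w: "z < w" "w < y" "arctan y - arctan z = (y - z) * inverse (1 + w\<^sup>2)"
      using MVT2[OF \<open>z < y\<close>, of arctan "\<lambda>w. inverse (1 + w\<^sup>2)"] DERIV_arctan by blast
    have "1 + w\<^sup>2 \<le> 2 * ((1 + x\<^sup>2) * (1 + d\<^sup>2))"
    proof -
      have "w\<^sup>2 \<le> 2 * x\<^sup>2 + 2 * (w - x)\<^sup>2"
        using zero_le_power2[of "w - 2 * x"] by (simp add: power2_eq_square algebra_simps)
      also have "\<dots> \<le> 2 * x\<^sup>2 + 2 * d\<^sup>2" using lim[OF w(1,2)] by simp
      finally have "w\<^sup>2 \<le> 2 * x\<^sup>2 + 2 * d\<^sup>2" .
      moreover have "0 \<le> x\<^sup>2 * d\<^sup>2" by simp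
      moreover have "2 * ((1 + x\<^sup>2) * (1 + d\<^sup>2)) = 2 + 2 * x\<^sup>2 + 2 * d\<^sup>2 + 2 * (x\<^sup>2 * d\<^sup>2)"
        by (simp add: algebra_simps)
      ultimately show ?thesis by linarith
    qed
    then have "1 / ((1 + x\<^sup>2) * (1 + d\<^sup>2)) \<le> 2 * inverse (1 + w\<^sup>2)"
      by (simp add: divide_simps add_pos_nonneg mult_pos_pos) 
    from mult_left_mono[OF this, of "y - z"] show ?thesis using that w by simp
  qed
  consider "d = 0" | "d > 0" | "d < 0" by linarith
  then show ?thesis
  proof cases
    case 2
    have "(w - x)\<^sup>2 \<le> d\<^sup>2" if "x < w" "w < x + d" for w
      using that by (intro power_mono) auto
    then show ?thesis using *[of x "x + d"] 2 arctan_monotone[of x "x + d"] by simp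
  next
    case 3
    have "(w - x)\<^sup>2 \<le> d\<^sup>2" if "x + d < w" "w < x" for w
      using that power_mono[of "x - w" "- d" 2] by (simp add: power2_commute)
    then show ?thesis using *[of "x + d" x] 3 arctan_monotone[of "x + d" x] by simp
  qed simp
qed

lemma sum_abs_diff_arctan_le:
  fixes k :: "nat \<Rightarrow> real"
  assumes "(\<forall>i. a \<le> i \<and> i < b \<longrightarrow> k i \<le> k (Suc i)) \<or> (\<forall>i. a \<le> i \<and> i < b \<longrightarrow> k (Suc i) \<le> k i)"
  shows "(\<Sum>i=a..<b. \<bar>arctan (k (Suc i)) - arctan (k i)\<bar>) \<le> pi"
proof (cases "a \<le> b")
  case True
  have bd: "\<bar>arctan x - arctan y\<bar> \<le> pi" for x y
    using arctan_bounded[of x] arctan_bounded[of y] by linarith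
  have S0: "(\<Sum>i=a..<b. \<bar>arctan (k (Suc i)) - arctan (k i)\<bar>) \<ge> 0" by (intro sum_nonneg) auto
  have "(\<Sum>i=a..<b. \<bar>arctan (k (Suc i)) - arctan (k i)\<bar>) = \<bar>\<Sum>i=a..<b. arctan (k (Suc i)) - arctan (k i)\<bar>"
    using assms
  proof
    assume A: "\<forall>i. a \<le> i \<and> i < b \<longrightarrow> k i \<le> k (Suc i)"
    then have "(\<Sum>i=a..<b. \<bar>arctan (k (Suc i)) - arctan (k i)\<bar>) = (\<Sum>i=a..<b. arctan (k (Suc i)) - arctan (k i))"
      by (intro sum.cong) (auto simp: arctan_monotone')
    then show ?thesis using S0 by linarith
  next
    assume A: "\<forall>i. a \<le> i \<and> i < b \<longrightarrow> k (Suc i) \<le> k i"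
    then have "(\<Sum>i=a..<b. \<bar>arctan (k (Suc i)) - arctan (k i)\<bar>) = (\<Sum>i=a..<b. -(arctan (k (Suc i)) - arctan (k i)))"
      by (intro sum.cong) (auto simp: arctan_monotone')
    then show ?thesis using S0 unfolding sum_negf by linarith
  qed
  also have "(\<Sum>i=a..<b. arctan (k (Suc i)) - arctan (k i)) = arctan (k b) - arctan (k a)"
    using True by (rule sum_Suc_diff')
  finally show ?thesis using bd by simp
qed simp

text \<open>The increments change sign at most once, so \<open>arctan \<circ> k\<close> has total variation at most \<open>2\<pi>\<close>.\<close>

lemma sum_quadratic_sequence_le:
  fixes k d :: "nat \<Rightarrow> real"
  assumes k: "\<And>i. k (Suc i) = k i + d i" and d: "\<And>i. d i = d0 + real i * e"
  shows "(\<Sum>i<M. \<bar>d i\<bar> / ((1 + (k i)\<^sup>2) * (1 + (d i)\<^sup>2))) \<le> 4 * pi"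
proof -
  define m where "m = (if \<exists>i. d i * d 0 < 0 then (LEAST i. d i * d 0 < 0) else M)"
  have lin: "d i = d 0 + real i * e" for i using d[of i] d[of 0] by simp
  have lt: "d i * d 0 \<ge> 0" if "i < m" "i < M" for i
    using that not_less_Least[of i "\<lambda>i. d i * d 0 < 0"] unfolding m_def
    by (auto split: if_splits) (meson not_less)
  \<comment> \<open>At \<open>m\<close> the affine increment has already changed sign, which forces
    \<open>e * d 0 < 0\<close>; from there on it only moves further away from the sign of
    \<open>d 0\<close>.\<close>
  have ge: "d i * d 0 \<le> 0" if "i \<ge> m" "i < M" for i
  proof -
    have ex: "\<exists>i. d i * d 0 < 0" using that unfolding m_def by (auto split: if_splits)
    then have m: "d m * d 0 < 0" unfolding m_def by (simp add: LeastI_ex[OF ex])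
    then have "real m * (e * d 0) < 0" using zero_le_square[of "d 0"]
      unfolding lin[of m] by (simp only: distrib_right mult.assoc)
    then have "e * d 0 < 0" by (simp add: mult_less_0_iff)
    then have "real i * (e * d 0) \<le> real m * (e * d 0)"
      using that by (intro mult_right_mono_neg) auto
    then show ?thesis using m lin[of m] lin[of i] by (simp add: algebra_simps)
  qed
  define m' where "m' = min m M"
  have tv: "(\<Sum>i=a..<b. \<bar>arctan (k (Suc i)) - arctan (k i)\<bar>) \<le> pi"
    if "(\<forall>i. a \<le> i \<and> i < b \<longrightarrow> d i * d 0 \<ge> 0) \<or> (\<forall>i. a \<le> i \<and> i < b \<longrightarrow> d i * d 0 \<le> 0)"
      and "d 0 \<noteq> 0" for a b
  proof (rule sum_abs_diff_arctan_le)
    show "(\<forall>i. a \<le> i \<and> i < b \<longrightarrow> k i \<le> k (Suc i)) \<or> (\<forall>i. a \<le> i \<and> i < b \<longrightarrow> k (Suc i) \<le> k i)"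
      using that unfolding k zero_le_mult_iff mult_le_0_iff by (cases "d 0 > 0") auto
  qed
  have "(\<Sum>i<M. \<bar>d i\<bar> / ((1 + (k i)\<^sup>2) * (1 + (d i)\<^sup>2))) \<le> (\<Sum>i<M. 2 * \<bar>arctan (k (Suc i)) - arctan (k i)\<bar>)"
    unfolding k by (intro sum_mono arctan_diff_ge)
  also have "\<dots> = 2 * (\<Sum>i<M. \<bar>arctan (k (Suc i)) - arctan (k i)\<bar>)" by (simp add: sum_distrib_left)
  also have "(\<Sum>i<M. \<bar>arctan (k (Suc i)) - arctan (k i)\<bar>) \<le> 2 * pi"
  proof (cases "d 0 = 0")
    \<comment> \<open>Products with \<open>d 0\<close> carry no sign information here, but
      \<open>d i = i * e\<close> never changes sign, so a single monotone stretch is enough.\<close>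
    case True
    then have d: "d i = real i * e" for i using lin[of i] by simp
    have "(\<Sum>i=0..<M. \<bar>arctan (k (Suc i)) - arctan (k i)\<bar>) \<le> pi"
    proof (rule sum_abs_diff_arctan_le)
      show "(\<forall>i. 0 \<le> i \<and> i < M \<longrightarrow> k i \<le> k (Suc i)) \<or> (\<forall>i. 0 \<le> i \<and> i < M \<longrightarrow> k (Suc i) \<le> k i)"
        unfolding k d by (cases "e \<ge> 0") (auto simp: mult_nonneg_nonpos)
    qed
    then show ?thesis unfolding atLeast0LessThan using pi_ge_zero by linarith
  next
    case False
    have "(\<Sum>i<M. \<bar>arctan (k (Suc i)) - arctan (k i)\<bar>) =
      (\<Sum>i=0..<m'. \<bar>arctan (k (Suc i)) - arctan (k i)\<bar>) + (\<Sum>i=m'..<M. \<bar>arctan (k (Suc i)) - arctan (k i)\<bar>)"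
      by (subst sum.atLeastLessThan_concat) (auto simp: m'_def atLeast0LessThan)
    also have "\<dots> \<le> pi + pi"
      using False lt ge by (intro add_mono tv) (auto simp: m'_def)
    finally show ?thesis by simp
  qed
  finally show ?thesis by simp
qed

text \<open>An arithmetic progression of step \<open>1 / l\<close> is the case \<open>e = 0\<close>
  of the previous lemma. The factor \<open>2 * l\<close> undoes
  \<open>\<bar>d\<bar> / (1 + d^2)\<close> for \<open>d = 1 / l <= 1\<close>.\<close>

lemma sum_inverse_square_int_le:
  fixes A :: "int set" and l \<mu> :: real
  assumes "finite A" "l \<ge> 1"
  shows "(\<Sum>i\<in>A. 1 / (1 + ((of_int i - \<mu>) / l)\<^sup>2)) \<le> 8 * pi * l"
proof -
  obtain n :: int where n: "A \<subseteq> {n..}"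
    using bdd_below_finite[OF assms(1)] by (auto simp: bdd_below_def)
  obtain n' :: int where n': "A \<subseteq> {..n'}"
    using bdd_above_finite[OF assms(1)] by (auto simp: bdd_above_def)
  define M where "M = nat (n' - n + 1)"
  define k where "k i = (of_int (n + int i) - \<mu>) / l" for i
  have "(\<Sum>i<M. \<bar>1/l\<bar> / ((1 + (k i)\<^sup>2) * (1 + (1/l)\<^sup>2))) \<le> 4 * pi"
    by (rule sum_quadratic_sequence_le[of k _ "1/l" 0]) (auto simp: k_def divide_simps)
  moreover have "1 / (1 + (k i)\<^sup>2) \<le> (2 * l) * (\<bar>1/l\<bar> / ((1 + (k i)\<^sup>2) * (1 + (1/l)\<^sup>2)))" for i
  proof -
    have "1 + (1/l)\<^sup>2 \<le> 2" using assms power_le_one[of "1/l" 2] by simp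
    moreover have "0 < 1 + (1/l)\<^sup>2" "0 < 1 + (k i)\<^sup>2" by (simp_all add: add_pos_nonneg)
    ultimately show ?thesis using assms by (simp add: divide_simps split: if_splits)
  qed
  then have "(\<Sum>i<M. 1 / (1 + (k i)\<^sup>2)) \<le> (\<Sum>i<M. (2 * l) * (\<bar>1/l\<bar> / ((1 + (k i)\<^sup>2) * (1 + (1/l)\<^sup>2))))"
    by (intro sum_mono)
  ultimately have "(\<Sum>i<M. 1 / (1 + (k i)\<^sup>2)) \<le> (2 * l) * (4 * pi)"
    using assms unfolding sum_distrib_left[symmetric]
    by (meson mult_left_mono order_trans zero_le_mult_iff zero_le_numeral zero_le_one)
  moreover have "(\<Sum>i\<in>A. 1 / (1 + ((of_int i - \<mu>) / l)\<^sup>2)) \<le> (\<Sum>i<M. 1 / (1 + (k i)\<^sup>2))"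
  proof -
    have "A \<subseteq> (\<lambda>i. n + int i) ` {..<M}"
    proof
      fix a assume "a \<in> A"
      then have "a \<ge> n" "a \<le> n'" using n n' by auto
      then have "a = n + int (nat (a - n))" "nat (a - n) < M" by (auto simp: M_def)
      then show "a \<in> (\<lambda>i. n + int i) ` {..<M}" by blast
    qed
    then have "(\<Sum>i\<in>A. 1 / (1 + ((of_int i - \<mu>) / l)\<^sup>2)) \<le>
      (\<Sum>i\<in>(\<lambda>i. n + int i) ` {..<M}. 1 / (1 + ((of_int i - \<mu>) / l)\<^sup>2))"
      by (intro sum_mono2) auto
    also have "\<dots> = (\<Sum>i<M. 1 / (1 + (k i)\<^sup>2))"
      by (subst sum.reindex) (auto simp: inj_on_def k_def)
    finally show ?thesis .
  qed
  ultimately show ?thesis by (simp add: mult_ac)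
qed

section \<open>Dyadic decomposition of the slabs\<close>

text \<open>With \<open>s = 2^j * d\<close> and \<open>c = m * s\<close>, the region where this form
  is \<open>O(1)\<close> is the box of sides about \<open>1 / (1 + s^2 / d)\<close>,
  \<open>d / s\<close> and \<open>d\<close> in the frame at \<open>c\<close>. On it
  \<open>fkappa\<close> changes by \<open>O(d)\<close> when the direction moves by at most
  \<open>s\<close>, so the box lies in the slabs of the whole arc. For \<open>j = 0\<close> it is
  the slab itself.\<close>

definition qform :: "real \<Rightarrow> nat \<Rightarrow> nat \<Rightarrow> (real \<times> real) \<times> real \<Rightarrow> real" where
  "qform d j m = aniso (real m * 2^j * d) (1 + (4^j * d)\<^sup>2) ((2^j)\<^sup>2) ((1/d)\<^sup>2)"

text \<open>At \<open>j = J\<close> nothing is subtracted: this piece keeps the frequencies closest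
  to the origin, and it needs no orthogonality because indices below \<open>2^J\<close> all lie in
  the single arc 0.\<close>

definition dyad :: "real \<Rightarrow> nat \<Rightarrow> nat \<Rightarrow> nat \<Rightarrow> (real \<times> real) \<times> real \<Rightarrow> real" where
  "dyad d J j m \<xi> = exp (- (qform d j m \<xi> / 2)) -
     (if j < J then exp (- (qform d (Suc j) (m div 2) \<xi> / 2)) else 0)"

lemma dyad_telescope:
  "exp (- (qform d 0 n \<xi> / 2)) = (\<Sum>j\<le>J. dyad d J j (n div 2^j) \<xi>)"
proof -
  have "(\<Sum>j<J. dyad d J j (n div 2^j) \<xi>) = exp (- (qform d 0 n \<xi> / 2)) - exp (- (qform d J (n div 2^J) \<xi> / 2))"
    using sum_lessThan_telescope'[of "\<lambda>j. exp (- (qform d j (n div 2^j) \<xi> / 2))" J]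
    by (simp add: dyad_def div_mult2_eq[symmetric] mult.commute)
  then show ?thesis by (simp add: lessThan_Suc_atMost[symmetric] dyad_def)
qed

section \<open>The size of one dyadic difference and its sum over the arcs\<close>

lemma exp_diff_abs_le:
  fixes x y c :: real
  assumes "c \<le> x" "c \<le> y"
  shows "\<bar>exp (- x) - exp (- y)\<bar> \<le> \<bar>x - y\<bar> * exp (- c)"
proof -
  have *: "exp (- x) - exp (- y) \<le> (y - x) * exp (- c)" if "x \<le> y" "c \<le> x" for x y
  proof -
    have "exp (- x) - exp (- y) = exp (- x) * (1 - exp (- (y - x)))"
      by (simp add: algebra_simps mult_exp_exp)
    also have "\<dots> \<le> exp (- c) * (y - x)"
      using that exp_ge_add_one_self[of "- (y - x)"]
      by (intro mult_mono) (simp_all del: exp_ge_add_one_self)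
    finally show ?thesis by (simp add: mult.commute)
  qed
  show ?thesis
  proof (cases "x \<le> y")
    case True then show ?thesis using *[of x y] assms by simp
  next
    case False then show ?thesis using *[of y x] assms by simp
  qed
qed

text \<open>\<open>240 = 3 * 80\<close>, so cubing produces \<open>exp (q / 80)\<close>, half of the
  decay \<open>exp (- (q / 40))\<close> available in \<open>dyad_bound_aux\<close>. The third power
  is one factor from the difference of the forms and two from \<open>abs_le_oweight\<close>.\<close>

lemma cube_le_exp:
  fixes q :: real
  assumes "q \<ge> 0"
  shows "(1 + q)^3 \<le> 240^3 * exp (q / 80)"
proof -
  have "1 + q \<le> 240 * exp (q / 240)" using exp_ge_add_one_self[of "q/240"] assms by linarith
  then have "(1 + q)^3 \<le> (240 * exp (q / 240))^3" using assms by (intro power_mono) auto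
  also have "\<dots> = 240^3 * exp (q / 80)"
    by (simp add: power_mult_distrib exp_of_nat_mult[symmetric])
  finally show ?thesis .
qed

text \<open>The increments of \<open>b\<close> and \<open>k\<close> along consecutive arcs are \<open>- 2 a\<close> and \<open>3 a - 3 b\<close>: the weight is made to be
  summed by \<open>sum_quadratic_sequence_le\<close>.\<close>

definition oweight :: "real \<Rightarrow> real \<Rightarrow> real \<Rightarrow> real" where
  "oweight a b k = \<bar>-2 * a\<bar> / ((1 + b\<^sup>2) * (1 + (-2 * a)\<^sup>2)) +
     \<bar>3 * a - 3 * b\<bar> / ((1 + k\<^sup>2) * (1 + (3 * a - 3 * b)\<^sup>2))"

text \<open>The two steps \<open>-2 a\<close> and \<open>3 a - 3 b\<close> together control
  \<open>a\<close> and \<open>b\<close>, and their denominators are at most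
  \<open>4 (1 + q)^2\<close> and \<open>18 (1 + q)^2\<close>.\<close>

lemma abs_le_oweight:
  fixes a b k q :: real
  assumes q: "a\<^sup>2 + b\<^sup>2 + k\<^sup>2 \<le> q"
  shows "\<bar>a\<bar> + \<bar>b\<bar> \<le> 40 * (1 + q)\<^sup>2 * oweight a b k"
proof -
  define D where "D = 3 * a - 3 * b"
  have q0: "0 \<le> q" and ab: "a\<^sup>2 \<le> q" "b\<^sup>2 \<le> q" "k\<^sup>2 \<le> q"
    using q zero_le_power2[of a] zero_le_power2[of b] zero_le_power2[of k] by linarith+
  have "D\<^sup>2 + 9 * (a + b)\<^sup>2 = 18 * a\<^sup>2 + 18 * b\<^sup>2"
    by (simp add: D_def power2_eq_square algebra_simps)
  then have "D\<^sup>2 \<le> 18 * q"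
    using q zero_le_power2[of k] zero_le_power2[of "a + b"] by linarith
  then have "(1 + k\<^sup>2) * (1 + D\<^sup>2) \<le> (1 + q) * (18 * (1 + q))"
    using ab q0 by (intro mult_mono) auto
  then have P2: "(1 + k\<^sup>2) * (1 + D\<^sup>2) \<le> 18 * (1 + q)\<^sup>2" by (simp only: power2_eq_square mult_ac)
  have "(1 + b\<^sup>2) * (1 + (-2 * a)\<^sup>2) \<le> (1 + q) * (4 * (1 + q))"
    using ab q0 by (intro mult_mono) (auto simp: power_mult_distrib)
  then have P1: "(1 + b\<^sup>2) * (1 + (-2 * a)\<^sup>2) \<le> 4 * (1 + q)\<^sup>2" by (simp only: power2_eq_square mult_ac)
  have pos: "(1 + b\<^sup>2) * (1 + (-2 * a)\<^sup>2) > 0" "(1 + k\<^sup>2) * (1 + D\<^sup>2) > 0"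
    by (simp_all add: add_pos_nonneg)
  have dv: "x \<le> B * (x / P)" if "P \<le> B" "P > 0" "x \<ge> 0" for x B P :: real
    using mult_right_mono[OF that(1,3)] that(2) by (simp add: field_simps)
  have "\<bar>a\<bar> + \<bar>b\<bar> \<le> \<bar>-2 * a\<bar> + \<bar>D\<bar>" unfolding D_def by linarith
  also have "\<dots> \<le> 4 * (1 + q)\<^sup>2 * (\<bar>-2 * a\<bar> / ((1 + b\<^sup>2) * (1 + (-2 * a)\<^sup>2))) +
      18 * (1 + q)\<^sup>2 * (\<bar>D\<bar> / ((1 + k\<^sup>2) * (1 + D\<^sup>2)))"
    using dv[OF P1 pos(1), of "\<bar>-2 * a\<bar>"] dv[OF P2 pos(2), of "\<bar>D\<bar>"] by linarith
  also have "\<dots> \<le> 40 * (1 + q)\<^sup>2 * (\<bar>-2 * a\<bar> / ((1 + b\<^sup>2) * (1 + (-2 * a)\<^sup>2))) +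
      40 * (1 + q)\<^sup>2 * (\<bar>D\<bar> / ((1 + k\<^sup>2) * (1 + D\<^sup>2)))"
    using pos by (intro add_mono mult_right_mono) (auto intro!: divide_nonneg_pos)
  finally show ?thesis by (simp add: oweight_def D_def distrib_left)
qed

lemma oweight_nonneg: "oweight a b k \<ge> 0"
  by (simp add: oweight_def)

text \<open>The primed coordinates are those of the same frequency relative to the parent arc, whose
  left endpoint is either the same or one arc further back. The coordinate \<open>k\<close> alone
  contributes nothing to \<open>q' - q\<close>, which is what produces the factor
  \<open>\<bar>a\<bar> + \<bar>b\<bar>\<close>.\<close>

lemma dyad_bound_aux:
  fixes x a b k a' b' k' :: real
  assumes a': "a' = 4 * a"
    and bk: "b' = 2 * b \<and> k' = k \<or> b' = 2 * (b + 2 * a) \<and> k' = k + 3 * b + 3 * a"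
    and q: "q = x\<^sup>2 + a\<^sup>2 + b\<^sup>2 + k\<^sup>2" and q': "q' = x\<^sup>2 + a'\<^sup>2 + b'\<^sup>2 + k'\<^sup>2"
  shows "\<bar>exp (- (q / 2)) - exp (- (q' / 2))\<bar> \<le> 10^11 * oweight a b k * exp (- (q / 80))"
proof -
  have sq: "0 \<le> x\<^sup>2" "0 \<le> a\<^sup>2" "0 \<le> b\<^sup>2" "0 \<le> k\<^sup>2" by simp_all
  have q0: "0 \<le> q" using sq q by linarith
  \<comment> \<open>The old coordinates are recovered linearly from the new ones, so both exponents
    \<open>q / 2\<close> and \<open>q' / 2\<close> are at least \<open>q / 40\<close>.\<close>
  have lower: "q \<le> 20 * q'"
    using bk
  proof
    assume "b' = 2 * b \<and> k' = k"
    then show ?thesis unfolding q q' a' using sq by (simp add: power_mult_distrib)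
  next
    assume h: "b' = 2 * (b + 2 * a) \<and> k' = k + 3 * b + 3 * a"
    have "k\<^sup>2 \<le> 3 * (k + 3 * b + 3 * a)\<^sup>2 + 27 * b\<^sup>2 + 27 * a\<^sup>2"
      using zero_le_power2[of "(k + 3*b + 3*a) + 3 * b"] zero_le_power2[of "(k + 3*b + 3*a) + 3 * a"]
        zero_le_power2[of "b - a"]
      by (simp add: power2_eq_square algebra_simps)
    moreover have "b\<^sup>2 \<le> 2 * (b + 2 * a)\<^sup>2 + 8 * a\<^sup>2"
      using zero_le_power2[of "b + 4 * a"] by (simp add: power2_eq_square algebra_simps)
    ultimately have "a\<^sup>2 + b\<^sup>2 + k\<^sup>2 \<le> 320 * a\<^sup>2 + 80 * (b + 2 * a)\<^sup>2 + 20 * (k + 3 * b + 3 * a)\<^sup>2"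
      using zero_le_power2[of "b + 2 * a"] zero_le_power2[of "k + 3 * b + 3 * a"] sq by linarith
    moreover have "q' = x\<^sup>2 + 16 * a\<^sup>2 + 4 * (b + 2 * a)\<^sup>2 + (k + 3 * b + 3 * a)\<^sup>2"
      unfolding q' a' using h by (simp add: power_mult_distrib del: distrib_left_numeral)
    ultimately show ?thesis unfolding q using sq(1) by linarith
  qed
  have ab: "\<bar>a\<bar> \<le> 1 + q" "\<bar>b\<bar> \<le> 1 + q" "\<bar>k\<bar> \<le> 1 + q"
  proof -
    have s: "\<bar>y\<bar> \<le> 1 + y\<^sup>2" for y :: real
      using zero_le_power2[of "\<bar>y\<bar> - 1"] by (simp add: power2_diff)
    show "\<bar>a\<bar> \<le> 1 + q" "\<bar>b\<bar> \<le> 1 + q" "\<bar>k\<bar> \<le> 1 + q"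
      using s[of a] s[of b] s[of k] sq q by linarith+
  qed
  have diff: "\<bar>q / 2 - q' / 2\<bar> \<le> 50 * (1 + q) * (\<bar>a\<bar> + \<bar>b\<bar>)"
  proof -
    define P where "P = (if b' = 2 * b \<and> k' = k then 15 * a else 40 * a + 34 * b + 6 * k)"
    define S where "S = (if b' = 2 * b \<and> k' = k then 3 * b else 12 * b + 6 * k)"
    have e: "q' - q = a * P + b * S"
      using bk unfolding q q' a' P_def S_def
      by (auto simp: power2_eq_square algebra_simps)
    have "\<bar>P\<bar> \<le> 100 * (1 + q)" "\<bar>S\<bar> \<le> 100 * (1 + q)"
      using ab q0 by (auto simp: P_def S_def abs_le_iff abs_if split: if_splits)
    then have "\<bar>a\<bar> * \<bar>P\<bar> + \<bar>b\<bar> * \<bar>S\<bar> \<le> \<bar>a\<bar> * (100 * (1 + q)) + \<bar>b\<bar> * (100 * (1 + q))"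
      by (intro add_mono mult_left_mono) auto
    moreover have "\<bar>q' - q\<bar> \<le> \<bar>a\<bar> * \<bar>P\<bar> + \<bar>b\<bar> * \<bar>S\<bar>"
      unfolding e abs_mult[symmetric] by (rule abs_triangle_ineq)
    moreover have "\<bar>q / 2 - q' / 2\<bar> = \<bar>q' - q\<bar> / 2" by (simp add: abs_if)
    ultimately show ?thesis by (simp add: algebra_simps)
  qed
  have "\<bar>exp (- (q / 2)) - exp (- (q' / 2))\<bar> \<le> \<bar>q / 2 - q' / 2\<bar> * exp (- (q / 40))"
    using lower q0 by (intro exp_diff_abs_le) auto
  also have "\<dots> \<le> (50 * (1 + q) * (40 * (1 + q)\<^sup>2 * oweight a b k)) * exp (- (q / 40))"
  proof (intro mult_right_mono)
    have "\<bar>a\<bar> + \<bar>b\<bar> \<le> 40 * (1 + q)\<^sup>2 * oweight a b k" using q sq by (intro abs_le_oweight) linarith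
    then show "\<bar>q / 2 - q' / 2\<bar> \<le> 50 * (1 + q) * (40 * (1 + q)\<^sup>2 * oweight a b k)"
      using diff q0 by (meson mult_left_mono order_trans add_nonneg_nonneg zero_le_mult_iff zero_le_numeral zero_le_one)
  qed simp
  also have "\<dots> = (2000 * oweight a b k) * ((1 + q)^3 * exp (- (q / 40)))"
    by (simp add: power2_eq_square power3_eq_cube)
  also have "\<dots> \<le> (2000 * oweight a b k) * ((240^3 * exp (q / 80)) * exp (- (q / 40)))"
    using q0 by (intro mult_left_mono mult_right_mono cube_le_exp) (auto simp: oweight_nonneg)
  also have "\<dots> = (2000 * 240^3) * (oweight a b k * exp (- (q / 80)))"
    by (simp add: mult_exp_exp)
  \<comment> \<open>\<open>2000 = 50 * 40\<close>, and \<open>2000 * 240^3\<close> is about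
    \<open>2.8 * 10^10\<close>.\<close>
  also have "\<dots> \<le> 10^11 * (oweight a b k * exp (- (q / 80)))"
    by (intro mult_right_mono) (auto simp: oweight_nonneg)
  finally show ?thesis by (simp add: mult.assoc)
qed

text \<open>The arguments are the coordinates of the frequency in units of the sides of the box, so
  that their squares are the last three terms in \<open>qform_alt\<close>. At the last scale, with
  one arc, the constant 1 is summable by itself.\<close>

definition sweight :: "real \<Rightarrow> nat \<Rightarrow> nat \<Rightarrow> nat \<Rightarrow> (real \<times> real) \<times> real \<Rightarrow> real" where
  "sweight d J j m \<xi> = (if j < J then oweight (4^j * d * fst (fst \<xi>))
     (2^j * fbeta (real m * 2^j * d) \<xi>) (fkappa (real m * 2^j * d) \<xi> / d) else 1)"

lemma sweight_nonneg: "sweight d J j m \<xi> \<ge> 0"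
  by (simp add: sweight_def oweight_nonneg)

lemma qform_alt:
  "qform d j m \<xi> = (fst (fst \<xi>))\<^sup>2 + (4^j * d * fst (fst \<xi>))\<^sup>2 +
     (2^j * fbeta (real m * 2^j * d) \<xi>)\<^sup>2 + (fkappa (real m * 2^j * d) \<xi> / d)\<^sup>2"
  by (simp add: qform_def aniso_def power_mult_distrib power_divide distrib_right)

lemma qform_nonneg: "qform d j m \<xi> \<ge> 0"
  by (simp add: qform_alt)

text \<open>Halving \<open>m\<close> keeps the left endpoint of the arc for even \<open>m\<close>
  and moves it back by \<open>2^j * d\<close> for odd \<open>m\<close>; these are the two cases of
  \<open>dyad_bound_aux\<close>.\<close>

lemma dyad_bound:
  assumes d: "d > 0"
  shows "\<bar>dyad d J j m \<xi>\<bar> \<le> 10^11 * sweight d J j m \<xi> * exp (- (qform d j m \<xi> / 80))"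
proof (cases "j < J")
  case True
  define m' where "m' = m div 2"
  have m': "m = 2 * m' \<or> m = 2 * m' + 1" unfolding m'_def by presburger
  have "\<bar>exp (- (qform d j m \<xi> / 2)) - exp (- (qform d (Suc j) m' \<xi> / 2))\<bar> \<le> 
     10^11 * oweight (4^j * d * fst (fst \<xi>))
     (2^j * fbeta (real m * 2^j * d) \<xi>) (fkappa (real m * 2^j * d) \<xi> / d) * exp (- (qform d j m \<xi> / 80))"
  proof (rule dyad_bound_aux[OF _ _ qform_alt qform_alt])
    have e: "(4::real)^j = 2^j * 2^j" by (simp flip: power_mult_distrib)
    show "2 ^ Suc j * fbeta (real m' * 2 ^ Suc j * d) \<xi> = 2 * (2 ^ j * fbeta (real m * 2 ^ j * d) \<xi>) \<and>
      fkappa (real m' * 2 ^ Suc j * d) \<xi> / d = fkappa (real m * 2 ^ j * d) \<xi> / d \<or>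
      2 ^ Suc j * fbeta (real m' * 2 ^ Suc j * d) \<xi> =
      2 * (2 ^ j * fbeta (real m * 2 ^ j * d) \<xi> + 2 * (4 ^ j * d * fst (fst \<xi>))) \<and>
      fkappa (real m' * 2 ^ Suc j * d) \<xi> / d =
      fkappa (real m * 2 ^ j * d) \<xi> / d + 3 * (2 ^ j * fbeta (real m * 2 ^ j * d) \<xi>) +
      3 * (4 ^ j * d * fst (fst \<xi>))"
      using m' d unfolding e
      by (elim disjE) (simp_all add: fbeta_def fkappa_def field_simps power2_eq_square)
  qed simp
  then show ?thesis using True by (simp add: dyad_def sweight_def m'_def)
next
  case False
  then have "\<bar>dyad d J j m \<xi>\<bar> = exp (- (qform d j m \<xi> / 2))" by (simp add: dyad_def)
  also have "\<dots> \<le> exp (- (qform d j m \<xi> / 80))" using qform_nonneg[of d j m \<xi>] by simp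
  finally show ?thesis using False by (simp add: sweight_def)
qed

text \<open>This is the almost orthogonality of the arcs of one scale. From arc to arc
  \<open>b\<close> runs through an arithmetic progression and \<open>k\<close> through a quadratic
  sequence, and each of them contributes at most \<open>4 * pi\<close>.\<close>

lemma sum_sweight_le:
  assumes d: "d > 0" and A: "finite A" "J \<le> j \<Longrightarrow> A \<subseteq> {0}"
  shows "(\<Sum>m\<in>A. sweight d J j m \<xi>) \<le> 8 * pi"
proof (cases "j < J")
  case True
  define a where "a = 4^j * d * fst (fst \<xi>)"
  define b where "b m = 2^j * fbeta (real m * 2^j * d) \<xi>" for m
  define k where "k m = fkappa (real m * 2^j * d) \<xi> / d" for m
  have e: "(4::real)^j = 2^j * 2^j" by (simp flip: power_mult_distrib)
  have bs: "b (Suc m) = b m + (-2 * a)" for m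
    by (simp add: b_def a_def e fbeta_def algebra_simps)
  have ks: "k (Suc m) = k m + (3 * a - 3 * b m)" for m
    using d by (simp add: k_def b_def a_def e fbeta_def fkappa_def field_simps power2_eq_square)
  have bl: "b m = b 0 + real m * (-2 * a)" for m
    by (induction m) (simp_all add: bs algebra_simps)
  have bl': "3 * a - 3 * b m = 3 * a - 3 * b 0 + real m * (6 * a)" for m
    using bl[of m] by (simp add: algebra_simps)
  obtain M where M: "A \<subseteq> {..<M}" using A(1) finite_nat_iff_bounded by blast
  have "(\<Sum>m\<in>A. sweight d J j m \<xi>) \<le> (\<Sum>m<M. sweight d J j m \<xi>)"
    using M by (intro sum_mono2) (auto simp: sweight_nonneg)
  also have "\<dots> = (\<Sum>m<M. \<bar>-2 * a\<bar> / ((1 + (b m)\<^sup>2) * (1 + (-2 * a)\<^sup>2))) +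
     (\<Sum>m<M. \<bar>3 * a - 3 * b m\<bar> / ((1 + (k m)\<^sup>2) * (1 + (3 * a - 3 * b m)\<^sup>2)))"
    using True by (simp only: sweight_def oweight_def a_def b_def k_def sum.distrib if_True)
  also have "\<dots> \<le> 4 * pi + 4 * pi"
    by (intro add_mono sum_quadratic_sequence_le[of b "\<lambda>_. -2 * a" "-2 * a" 0, OF bs]
        sum_quadratic_sequence_le[of k "\<lambda>m. 3 * a - 3 * b m", OF ks bl']) simp
  finally show ?thesis by simp
next
  case False
  then have "(\<Sum>m\<in>A. sweight d J j m \<xi>) = card A" by (simp add: sweight_def)
  also have "\<dots> \<le> 1" using A False card_mono[of "{0}" A] by simp
  also have "\<dots> \<le> 8 * pi" using pi_ge_two by simp
  finally show ?thesis .
qed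

text \<open>For \<open>c\<close> in \<open>[0,1]\<close> the slanted coordinates distort the
  standard ones boundedly. Hence all pieces decay at least like one fixed isotropic Gaussian, and
  the wave of the points can be estimated once for all scales.\<close>

lemma qform_ge:
  assumes d: "0 < d" "d \<le> 1" and m: "real m * 2^j * d \<le> 1"
  shows "(fst (fst \<xi>))\<^sup>2 + (snd (fst \<xi>))\<^sup>2 + (snd \<xi>)\<^sup>2 \<le> 400 * qform d j m \<xi>"
proof -
  define c where "c = real m * 2^j * d"
  have c: "0 \<le> c" "c \<le> 1" using d m by (simp_all add: c_def)
  obtain x y z where xi: "\<xi> = ((x, y), z)" by (metis prod.exhaust)
  define b where "b = fbeta c \<xi>"
  define k where "k = fkappa c \<xi>"
  have y: "y = b + 2 * c * x" and z: "z = k + (3 * c * y - 3 * c\<^sup>2 * x)"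
    by (simp_all add: b_def k_def fbeta_def fkappa_def xi)
  have sq2: "(s + t)\<^sup>2 \<le> 2 * s\<^sup>2 + 2 * t\<^sup>2" for s t :: real
    using zero_le_power2[of "s - t"] by (simp add: power2_eq_square algebra_simps)
  define W where "W = 3 * c * y - 3 * c\<^sup>2 * x"
  have cc: "(c * x)\<^sup>2 \<le> x\<^sup>2" "(c * y)\<^sup>2 \<le> y\<^sup>2" "(c\<^sup>2 * x)\<^sup>2 \<le> x\<^sup>2"
    using c by (auto simp: power_mult_distrib power_le_one intro!: mult_left_le_one_le)
  have "y\<^sup>2 \<le> 2 * b\<^sup>2 + 8 * (c * x)\<^sup>2"
    using sq2[of b "2 * (c * x)"] unfolding y by (simp add: power_mult_distrib mult.assoc)
  then have Y: "y\<^sup>2 \<le> 2 * b\<^sup>2 + 8 * x\<^sup>2" using cc(1) by linarith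
  have "W\<^sup>2 \<le> 18 * (c * y)\<^sup>2 + 18 * (c\<^sup>2 * x)\<^sup>2"
    using sq2[of "3 * (c * y)" "- 3 * (c\<^sup>2 * x)"] unfolding power_mult_distrib[of 3] power_mult_distrib[of "-3"]
    by (simp add: mult.assoc W_def)
  then have W: "W\<^sup>2 \<le> 18 * y\<^sup>2 + 18 * x\<^sup>2" using cc(2,3) by linarith
  have "z\<^sup>2 \<le> 2 * k\<^sup>2 + 2 * W\<^sup>2"
    unfolding z W_def by (rule sq2)
  then have "z\<^sup>2 \<le> 2 * k\<^sup>2 + 36 * y\<^sup>2 + 36 * x\<^sup>2" using W by linarith
  then have 1: "x\<^sup>2 + y\<^sup>2 + z\<^sup>2 \<le> 400 * (x\<^sup>2 + b\<^sup>2 + k\<^sup>2)"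
    unfolding distrib_left
    using Y zero_le_power2[of b] zero_le_power2[of k] zero_le_power2[of x] by linarith
  have "b\<^sup>2 \<le> (2^j * b)\<^sup>2"
    by (simp add: power_mult_distrib mult_le_cancel_right1 one_le_power)
  moreover have "k\<^sup>2 \<le> (k / d)\<^sup>2"
    using d power_le_one[of d 2] by (simp add: power_divide divide_simps mult_left_le)
  ultimately have "x\<^sup>2 + b\<^sup>2 + k\<^sup>2 \<le> qform d j m \<xi>"
    unfolding qform_alt c_def[symmetric] b_def[symmetric] k_def[symmetric]
    using zero_le_power2[of "4^j * d * x"] by (simp only: xi fst_conv snd_conv)
  then show ?thesis using 1 by (simp add: xi)
qed

section \<open>The multiscale incidence inequality\<close>

lemma phase_diff: "phase (x - y) \<xi> = phase x \<xi> - phase y \<xi>"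
  by (simp add: phase_def algebra_simps)

lemma ucoord_diff: "ucoord c (x - y) = ucoord c x - ucoord c y"
  by (simp add: ucoord_def algebra_simps)

text \<open>The Fourier transform of \<open>exp (- t q / 2)\<close>, a Gaussian on the dual box. The
  tubes themselves use \<open>t = 1\<close>; the decay \<open>exp (- q / 80)\<close> left by
  \<open>dyad_bound\<close> corresponds to \<open>t = 1/40\<close>.\<close>

definition qkernel :: "real \<Rightarrow> real \<Rightarrow> nat \<Rightarrow> nat \<Rightarrow> real^3 \<Rightarrow> real" where
  "qkernel t d j m x = sqrt (2 * pi / t) ^ 3 * d / (sqrt (1 + (4^j * d)\<^sup>2) * 2^j) *
     exp (- (((ucoord (real m * 2^j * d) x)\<^sup>2 / (1 + (4^j * d)\<^sup>2) +
        (vcoord (real m * 2^j * d) x / 2^j)\<^sup>2 + (d * x $ 3)\<^sup>2) / (2 * t)))"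

lemma fourier_qform:
  assumes "t > 0" "d > 0"
  shows "integrable lborel (\<lambda>\<xi>. of_real (exp (- (t * qform d j m \<xi> / 2))) * cis (phase x \<xi>))" (is ?A)
    and "(\<integral>\<xi>. of_real (exp (- (t * qform d j m \<xi> / 2))) * cis (phase x \<xi>) \<partial>lborel) =
      of_real (qkernel t d j m x)" (is ?B)
proof -
  define c where "c = real m * 2^j * d"
  define P where "P = 1 + (4^j * d)\<^sup>2"
  have P: "P > 0" by (simp add: P_def add_pos_nonneg)
  have e: "t * qform d j m \<xi> = aniso c (t * P) (t * (2^j)\<^sup>2) (t * (1/d)\<^sup>2) \<xi>" for \<xi>
    by (simp add: qform_def aniso_def c_def P_def algebra_simps)
  have pos: "t * P > 0" "t * (2^j)\<^sup>2 > 0" "t * (1/d)\<^sup>2 > 0" using assms P by simp_all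
  show ?A unfolding e by (rule fourier_aniso(1)[OF pos])
  have "sqrt (2 * pi / (t * P)) = sqrt (2 * pi / t) / sqrt P"
    "sqrt (2 * pi / (t * (2^j)\<^sup>2)) = sqrt (2 * pi / t) / 2^j"
    "sqrt (2 * pi / (t * (1/d)\<^sup>2)) = sqrt (2 * pi / t) * d"
    using assms P by (simp_all add: real_sqrt_divide real_sqrt_mult power_divide)
  then have 1: "sqrt (2 * pi / (t * P)) * sqrt (2 * pi / (t * (2^j)\<^sup>2)) * sqrt (2 * pi / (t * (1/d)\<^sup>2)) =
      sqrt (2 * pi / t) ^ 3 * d / (sqrt P * 2^j)"
    by (simp add: power3_eq_cube)
  have 2: "((ucoord c x)\<^sup>2 / (t * P) + (vcoord c x)\<^sup>2 / (t * (2^j)\<^sup>2) + (x $ 3)\<^sup>2 / (t * (1/d)\<^sup>2)) / 2 =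
     ((ucoord c x)\<^sup>2 / P + (vcoord c x / 2^j)\<^sup>2 + (d * x $ 3)\<^sup>2) / (2 * t)"
    using assms P by (simp add: power_divide power_mult_distrib add_divide_distrib mult_ac)
  show ?B unfolding e fourier_aniso(2)[OF pos] 1 2
    by (simp add: qkernel_def c_def P_def)
qed

text \<open>Expanding the square turns a weighted energy in frequency space into a smooth count of
  pairs of points in physical space.\<close>

lemma fourier_sum_square:
  fixes E :: "(real \<times> real) \<times> real \<Rightarrow> real" and y :: "'a \<Rightarrow> real^3"
  assumes I: "\<And>x. integrable lborel (\<lambda>\<xi>. of_real (E \<xi>) * cis (phase x \<xi>))"
    and k: "\<And>x. (\<integral>\<xi>. of_real (E \<xi>) * cis (phase x \<xi>) \<partial>lborel) = of_real (k x)"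
  shows "integrable lborel (\<lambda>\<xi>. E \<xi> * (cmod (\<Sum>i\<in>S. cis (phase (y i) \<xi>)))\<^sup>2)"
    and "(\<integral>\<xi>. E \<xi> * (cmod (\<Sum>i\<in>S. cis (phase (y i) \<xi>)))\<^sup>2 \<partial>lborel) = (\<Sum>i\<in>S. \<Sum>j\<in>S. k (y i - y j))"
proof -
  have e: "E \<xi> * (cmod (\<Sum>i\<in>S. cis (phase (y i) \<xi>)))\<^sup>2 =
      (\<Sum>i\<in>S. \<Sum>j\<in>S. Re (of_real (E \<xi>) * cis (phase (y i - y j) \<xi>)))" for \<xi>
  proof -
    have "of_real ((cmod (\<Sum>i\<in>S. cis (phase (y i) \<xi>)))\<^sup>2) =
        (\<Sum>i\<in>S. cis (phase (y i) \<xi>)) * cnj (\<Sum>i\<in>S. cis (phase (y i) \<xi>))"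
      by (rule complex_norm_square)
    also have "\<dots> = (\<Sum>i\<in>S. \<Sum>j\<in>S. cis (phase (y i - y j) \<xi>))"
      by (simp add: sum_product cis_cnj cis_mult phase_diff)
    finally have "of_real (E \<xi> * (cmod (\<Sum>i\<in>S. cis (phase (y i) \<xi>)))\<^sup>2) =
        (\<Sum>i\<in>S. \<Sum>j\<in>S. of_real (E \<xi>) * cis (phase (y i - y j) \<xi>))"
      by (simp add: sum_distrib_left)
    then have "Re (of_real (E \<xi> * (cmod (\<Sum>i\<in>S. cis (phase (y i) \<xi>)))\<^sup>2)) =
        Re (\<Sum>i\<in>S. \<Sum>j\<in>S. of_real (E \<xi>) * cis (phase (y i - y j) \<xi>))" by simp
    then show ?thesis by (simp only: Re_complex_of_real Re_sum)
  qed
  have Ir: "integrable lborel (\<lambda>\<xi>. Re (of_real (E \<xi>) * cis (phase x \<xi>)))" for x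
    using I by (rule integrable_Re)
  have kr: "(\<integral>\<xi>. Re (of_real (E \<xi>) * cis (phase x \<xi>)) \<partial>lborel) = k x" for x
    using integral_Re[OF I[of x]] k[of x] by simp
  show "integrable lborel (\<lambda>\<xi>. E \<xi> * (cmod (\<Sum>i\<in>S. cis (phase (y i) \<xi>)))\<^sup>2)"
    unfolding e by (intro Bochner_Integration.integrable_sum Ir)
  show "(\<integral>\<xi>. E \<xi> * (cmod (\<Sum>i\<in>S. cis (phase (y i) \<xi>)))\<^sup>2 \<partial>lborel) = (\<Sum>i\<in>S. \<Sum>j\<in>S. k (y i - y j))"
    unfolding e by (simp only: Bochner_Integration.integral_sum Bochner_Integration.integrable_sum Ir kr)
qed

definition dyadic_cluster :: "'a set \<Rightarrow> ('a \<Rightarrow> nat) \<Rightarrow> nat \<Rightarrow> nat \<Rightarrow> 'a set" where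
  "dyadic_cluster \<T> n j m = {T \<in> \<T>. n T div 2^j = m}"

definition cluster_ids :: "'a set \<Rightarrow> ('a \<Rightarrow> nat) \<Rightarrow> nat \<Rightarrow> nat set" where
  "cluster_ids \<T> n j = (\<lambda>T. n T div 2^j) ` \<T>"

lemma sum_clusters:
  fixes f :: "'a \<Rightarrow> 'b::comm_monoid_add"
  assumes "finite \<T>"
  shows "(\<Sum>m\<in>cluster_ids \<T> n j. \<Sum>T\<in>dyadic_cluster \<T> n j m. f T) = (\<Sum>T\<in>\<T>. f T)"
  using assms unfolding cluster_ids_def dyadic_cluster_def by (intro sum.group) auto

text \<open>Each product of \<open>M\<close> with a cluster sum is split by
  \<open>2 x y <= t x^2 + y^2 / t\<close>, and the two halves use the weights differently. Once the
  Gaussian factor is replaced by \<open>\<Phi>\<close>, the half with \<open>M\<close> depends on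
  the arc only through its weight; summing the weights over a scale costs \<open>8 * pi\<close>, so
  only the number of scales is lost. In the other half each single weight is bounded by
  \<open>8 * pi\<close>.\<close>

lemma multiscale_pointwise:
  fixes y :: "'a \<Rightarrow> real^3" and M :: complex
  assumes fin: "finite \<T>" and d: "0 < d" "d \<le> 1"
    and n: "\<And>T. T \<in> \<T> \<Longrightarrow> n T < 2^J" "\<And>T. T \<in> \<T> \<Longrightarrow> real (n T) * d \<le> 1"
    and t: "t > 0"
  shows "cmod (M * (\<Sum>T\<in>\<T>. of_real (exp (- (qform d 0 (n T) \<xi> / 2))) * cis (phase (- y T) \<xi>)))
    \<le> 10^11 * (4 * pi) * (real (J + 1) * t *
         (exp (- (((fst (fst \<xi>))\<^sup>2 + (snd (fst \<xi>))\<^sup>2 + (snd \<xi>)\<^sup>2) / 32000)) * (cmod M)\<^sup>2) +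
       (1 / t) * (\<Sum>j\<le>J. \<Sum>m\<in>cluster_ids \<T> n j. exp (- (qform d j m \<xi> / 80)) *
          (cmod (\<Sum>T\<in>dyadic_cluster \<T> n j m. cis (phase (- y T) \<xi>)))\<^sup>2))"
proof -
  \<comment> \<open>\<open>32000 = 80 * 400\<close>: the decay \<open>q / 80\<close> from
    \<open>dyad_bound\<close> and the comparison constant of \<open>qform_ge\<close>.\<close>
  define \<Phi> where "\<Phi> = exp (- (((fst (fst \<xi>))\<^sup>2 + (snd (fst \<xi>))\<^sup>2 + (snd \<xi>)\<^sup>2) / 32000))"
  define A where "A j m = (\<Sum>T\<in>dyadic_cluster \<T> n j m. cis (phase (- y T) \<xi>))" for j m
  define E where "E j m = exp (- (qform d j m \<xi> / 80))" for j m
  define w where "w j m = sweight d J j m \<xi>" for j m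
  have fi: "finite (cluster_ids \<T> n j)" for j using fin by (simp add: cluster_ids_def)
  have ci: "real m * 2^j * d \<le> 1" if "m \<in> cluster_ids \<T> n j" for m j
  proof -
    obtain T where T: "T \<in> \<T>" "m = n T div 2^j" using \<open>m \<in> _\<close> unfolding cluster_ids_def by auto
    have "m * 2^j \<le> n T" using T(2) by (simp add: div_times_less_eq_dividend)
    then have "real m * 2^j \<le> real (n T)" by (metis of_nat_le_iff of_nat_mult of_nat_numeral of_nat_power)
    then have "real m * 2^j * d \<le> real (n T) * d" using d by (intro mult_right_mono) auto
    then show ?thesis using n(2)[OF T(1)] by linarith
  qed
  have J: "cluster_ids \<T> n j \<subseteq> {0}" if "J \<le> j" for j
  proof
    fix m assume "m \<in> cluster_ids \<T> n j"
    then obtain T where T: "T \<in> \<T>" "m = n T div 2^j" unfolding cluster_ids_def by auto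
    have "n T < 2^j" using n(1)[OF T(1)] that by (meson less_le_trans one_le_numeral power_increasing)
    then show "m \<in> {0}" using T by simp
  qed
  have ws: "(\<Sum>m\<in>cluster_ids \<T> n j. w j m) \<le> 8 * pi" for j
    unfolding w_def using d(1) fi J by (rule sum_sweight_le)
  have w0: "w j m \<ge> 0" for j m by (simp add: w_def sweight_nonneg)
  have w1: "w j m \<le> 8 * pi" if "m \<in> cluster_ids \<T> n j" for j m
    using member_le_sum[OF that, of "w j"] w0 fi ws[of j] by fastforce
  have E: "E j m \<le> \<Phi>" if "m \<in> cluster_ids \<T> n j" for j m
    using qform_ge[OF d ci[OF that], of \<xi>] by (simp add: E_def \<Phi>_def)
  have "(\<Sum>T\<in>\<T>. of_real (exp (- (qform d 0 (n T) \<xi> / 2))) * cis (phase (- y T) \<xi>)) =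
      (\<Sum>T\<in>\<T>. \<Sum>j\<le>J. of_real (dyad d J j (n T div 2^j) \<xi>) * cis (phase (- y T) \<xi>))"
    by (simp add: dyad_telescope[of d _ \<xi> J] sum_distrib_right)
  also have "\<dots> = (\<Sum>j\<le>J. \<Sum>T\<in>\<T>. of_real (dyad d J j (n T div 2^j) \<xi>) * cis (phase (- y T) \<xi>))"
    by (rule sum.swap)
  also have "\<dots> = (\<Sum>j\<le>J. \<Sum>m\<in>cluster_ids \<T> n j. of_real (dyad d J j m \<xi>) * A j m)"
  proof (rule sum.cong[OF refl])
    fix j
    have "(\<Sum>T\<in>\<T>. of_real (dyad d J j (n T div 2^j) \<xi>) * cis (phase (- y T) \<xi>)) =
       (\<Sum>m\<in>cluster_ids \<T> n j. \<Sum>T\<in>dyadic_cluster \<T> n j m. of_real (dyad d J j (n T div 2^j) \<xi>) * cis (phase (- y T) \<xi>))"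
      by (rule sum_clusters[OF fin, symmetric])
    also have "\<dots> = (\<Sum>m\<in>cluster_ids \<T> n j. of_real (dyad d J j m \<xi>) * A j m)"
      by (auto simp: A_def sum_distrib_left dyadic_cluster_def intro!: sum.cong)
    finally show "(\<Sum>T\<in>\<T>. of_real (dyad d J j (n T div 2^j) \<xi>) * cis (phase (- y T) \<xi>)) =
       (\<Sum>m\<in>cluster_ids \<T> n j. of_real (dyad d J j m \<xi>) * A j m)" .
  qed
  finally have "cmod (M * (\<Sum>T\<in>\<T>. of_real (exp (- (qform d 0 (n T) \<xi> / 2))) * cis (phase (- y T) \<xi>))) =
     cmod (\<Sum>j\<le>J. \<Sum>m\<in>cluster_ids \<T> n j. of_real (dyad d J j m \<xi>) * (M * A j m))"
    by (simp add: sum_distrib_left mult_ac)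
  also have "\<dots> \<le> (\<Sum>j\<le>J. \<Sum>m\<in>cluster_ids \<T> n j. cmod (of_real (dyad d J j m \<xi>) * (M * A j m)))"
    by (intro order_trans[OF norm_sum] sum_mono norm_sum)
  also have "\<dots> \<le> (\<Sum>j\<le>J. \<Sum>m\<in>cluster_ids \<T> n j. 10^11 / 2 * t * (w j m * (\<Phi> * (cmod M)\<^sup>2)) +
      10^11 * (4 * pi) * (1 / t) * (E j m * (cmod (A j m))\<^sup>2))"
  proof (intro sum_mono)
    fix j m assume m: "m \<in> cluster_ids \<T> n j"
    have "2 * ((t * cmod M) * cmod (A j m)) \<le> (t * cmod M)\<^sup>2 + (cmod (A j m))\<^sup>2"
      using sum_squares_bound[of "t * cmod M" "cmod (A j m)"] by (simp add: mult.assoc)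
    then have am: "cmod M * cmod (A j m) \<le> (t * (cmod M)\<^sup>2 + (cmod (A j m))\<^sup>2 / t) / 2"
      using t by (simp add: field_simps power2_eq_square)
    have "cmod (of_real (dyad d J j m \<xi>) * (M * A j m)) = \<bar>dyad d J j m \<xi>\<bar> * (cmod M * cmod (A j m))"
      by (simp add: norm_mult)
    also have "\<dots> \<le> (10^11 * w j m * E j m) * ((t * (cmod M)\<^sup>2 + (cmod (A j m))\<^sup>2 / t) / 2)"
      using dyad_bound[OF d(1)] am w0 by (intro mult_mono) (auto simp: w_def E_def sweight_nonneg)
    also have "\<dots> = 10^11 / 2 * t * (w j m * (E j m * (cmod M)\<^sup>2)) +
        10^11 / 2 * (1 / t) * (w j m * (E j m * (cmod (A j m))\<^sup>2))"
      by (simp add: algebra_simps)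
    also have "\<dots> \<le> 10^11 / 2 * t * (w j m * (\<Phi> * (cmod M)\<^sup>2)) +
        10^11 / 2 * (1 / t) * (8 * pi * (E j m * (cmod (A j m))\<^sup>2))"
      using t w0 w1[OF m] E[OF m] by (intro add_mono mult_left_mono mult_right_mono) (auto simp: E_def)
    finally show "cmod (of_real (dyad d J j m \<xi>) * (M * A j m)) \<le>
       10^11 / 2 * t * (w j m * (\<Phi> * (cmod M)\<^sup>2)) + 10^11 * (4 * pi) * (1 / t) * (E j m * (cmod (A j m))\<^sup>2)"
      by (simp add: mult_ac)
  qed
  also have "\<dots> = (\<Sum>j\<le>J. 10^11 / 2 * t * ((\<Sum>m\<in>cluster_ids \<T> n j. w j m) * (\<Phi> * (cmod M)\<^sup>2))) +
      10^11 * (4 * pi) * (1 / t) * (\<Sum>j\<le>J. \<Sum>m\<in>cluster_ids \<T> n j. E j m * (cmod (A j m))\<^sup>2)"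
    by (simp only: sum.distrib sum_distrib_left sum_distrib_right)
  also have "(\<Sum>j\<le>J. 10^11 / 2 * t * ((\<Sum>m\<in>cluster_ids \<T> n j. w j m) * (\<Phi> * (cmod M)\<^sup>2))) \<le>
      (\<Sum>j\<le>J. 10^11 / 2 * t * (8 * pi * (\<Phi> * (cmod M)\<^sup>2)))"
    using t ws by (intro sum_mono mult_left_mono mult_right_mono) (auto simp: \<Phi>_def)
  also have "\<dots> = 10^11 * (4 * pi) * (real (J + 1) * t * (\<Phi> * (cmod M)\<^sup>2))"
    by (simp add: algebra_simps)
  finally show ?thesis
    by (simp only: \<Phi>_def[symmetric] A_def[symmetric] E_def[symmetric] distrib_left mult.assoc add_le_cancel_left add_le_cancel_right)
qed

section \<open>Bounds for the kernels and the energy of one cluster\<close>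

lemma ucoord_shift:
  "ucoord (c + h) x = ucoord c x + 2 * h * vcoord c x + 3 * h\<^sup>2 * x $ 3"
  by (simp add: ucoord_def vcoord_def power2_eq_square algebra_simps)

lemma exp_neg_le_inverse: "(x::real) \<ge> 0 \<Longrightarrow> exp (- x) \<le> 1 / (1 + x)"
  unfolding exp_minus inverse_eq_divide using exp_ge_add_one_self[of x]
  by (intro divide_left_mono mult_pos_pos) (simp_all del: exp_ge_add_one_self)

text \<open>Inverse quadratics suffice for the sums over points, and in product form they reduce to
  \<open>sum_inverse_square_int_le\<close> one coordinate at a time. First, a single factor.\<close>

lemma exp_norm_square_le:
  fixes x :: "real^3"
  assumes "s \<ge> 1"
  shows "exp (- (s * ((x $ 1)\<^sup>2 + (x $ 2)\<^sup>2 + (x $ 3)\<^sup>2))) \<le> (\<Prod>i\<in>UNIV. 1 / (1 + (x $ i)\<^sup>2))"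
proof -
  have "exp (- (s * ((x $ 1)\<^sup>2 + (x $ 2)\<^sup>2 + (x $ 3)\<^sup>2))) \<le> exp (- (x $ 1)\<^sup>2 + - (x $ 2)\<^sup>2 + - (x $ 3)\<^sup>2)"
    using mult_right_mono[OF assms, of "(x $ 1)\<^sup>2 + (x $ 2)\<^sup>2 + (x $ 3)\<^sup>2"] unfolding exp_le_cancel_iff by simp
  also have "\<dots> = exp (- (x $ 1)\<^sup>2) * exp (- (x $ 2)\<^sup>2) * exp (- (x $ 3)\<^sup>2)"
    unfolding exp_add ..
  also have "\<dots> \<le> 1 / (1 + (x $ 1)\<^sup>2) * (1 / (1 + (x $ 2)\<^sup>2)) * (1 / (1 + (x $ 3)\<^sup>2))"
    by (rule mult_mono, rule mult_mono; (rule exp_neg_le_inverse)?) simp_all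
  finally show ?thesis unfolding UNIV_3 by (simp add: mult.assoc)
qed

text \<open>In the frame at \<open>c\<close> the dual box has sides about \<open>l\<close>,
  \<open>2^j\<close> and \<open>1 / d\<close>. By \<open>ucoord_shift\<close>, turning the direction
  within the arc changes \<open>ucoord\<close> on this box by \<open>O(l)\<close>. So for every
  direction of the arc the box lies in a slab of thickness about \<open>l\<close> orthogonal to the
  tangent vector, and plates can count the tubes direction by direction.\<close>

lemma qkernel_le:
  assumes d: "d > 0" and h: "h < 2^j"
  shows "qkernel (1/40) d j m x \<le> sqrt (80 * pi) ^ 3 * d / (sqrt (1 + (4^j * d)\<^sup>2) * 2^j) *
     (1 / (1 + (ucoord (real (m * 2^j + h) * d) x / sqrt (1 + (4^j * d)\<^sup>2))\<^sup>2))"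
proof -
  define c where "c = real m * 2^j * d"
  define l where "l = sqrt (1 + (4^j * d)\<^sup>2)"
  have l2: "l\<^sup>2 = 1 + (4^j * d)\<^sup>2" by (simp add: l_def)
  have l: "l \<ge> 1" "4^j * d \<le> l" using d by (auto simp: l_def intro!: real_le_rsqrt)
  define X Y Z where "X = ucoord c x / l" and "Y = vcoord c x / 2^j" and "Z = d * x $ 3"
  define g where "g = real h / 2^j"
  have g: "0 \<le> g" "g \<le> 1" using h by (simp_all add: g_def divide_le_eq_1)
  define r where "r = 4^j * d / l"
  have r: "0 \<le> r" "r \<le> 1" using l d by (simp_all add: r_def divide_le_eq_1)
  have e4: "(4::real)^j = 2^j * 2^j" by (simp flip: power_mult_distrib)
  have gr: "g * r = real h * d * 2^j / l" "g\<^sup>2 * r = (real h)\<^sup>2 * d / l"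
    by (simp_all add: g_def r_def e4 power2_eq_square)
  have "ucoord (real (m * 2^j + h) * d) x = ucoord (c + real h * d) x" by (simp add: c_def algebra_simps)
  also have "\<dots> = l * X + 2 * (real h * d) * (2^j * Y) + 3 * (real h)\<^sup>2 * d * Z"
    using l unfolding ucoord_shift by (simp add: X_def Y_def Z_def power2_eq_square)
  finally have "ucoord (real (m * 2^j + h) * d) x / l = (l * X + 2 * (real h * d) * (2^j * Y) + 3 * (real h)\<^sup>2 * d * Z) / l" by simp
  also have "\<dots> = X + 2 * (g * r) * Y + 3 * (g\<^sup>2 * r) * Z"
    using l gr by (simp add: add_divide_distrib)
  finally have u: "ucoord (real (m * 2^j + h) * d) x / l = X + 2 * (g * r) * Y + 3 * (g\<^sup>2 * r) * Z" .
  define p q where "p = g * r" and "q = g\<^sup>2 * r"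
  have pq: "0 \<le> p" "p \<le> 1" "0 \<le> q" "q \<le> 1" using g r unfolding p_def q_def
    using mult_nonneg_nonneg[of g r] mult_nonneg_nonneg[of "g\<^sup>2" r] mult_le_one[of g r] mult_le_one[of "g\<^sup>2" r] power_le_one[of g 2]
    by simp_all
  have "p\<^sup>2 \<le> 1" "q\<^sup>2 \<le> 1" using pq by (simp_all add: power_le_one)
  then have pY: "(p * Y)\<^sup>2 \<le> Y\<^sup>2" "(q * Z)\<^sup>2 \<le> Z\<^sup>2"
    using mult_right_mono[of "p\<^sup>2" 1 "Y\<^sup>2"] mult_right_mono[of "q\<^sup>2" 1 "Z\<^sup>2"]
    by (simp_all add: power_mult_distrib)
  \<comment> \<open>Cauchy-Schwarz with \<open>14 = 1 + 4 + 9\<close>; the kernel with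
    \<open>t = 1/40\<close> offers \<open>20\<close>.\<close>
  have "(X + 2 * (p * Y) + 3 * (q * Z))\<^sup>2 \<le> 14 * (X\<^sup>2 + (p * Y)\<^sup>2 + (q * Z)\<^sup>2)"
  proof -
    have "14 * (X\<^sup>2 + a\<^sup>2 + b\<^sup>2) - (X + 2 * a + 3 * b)\<^sup>2 = (2 * X - a)\<^sup>2 + (3 * X - b)\<^sup>2 + (3 * a - 2 * b)\<^sup>2" for a b
      by (simp add: power2_eq_square algebra_simps)
    moreover have "0 \<le> (2 * X - a)\<^sup>2 + (3 * X - b)\<^sup>2 + (3 * a - 2 * b)\<^sup>2" for a b by simp
    ultimately show ?thesis by (metis diff_ge_0_iff_ge)
  qed
  also have "\<dots> \<le> 20 * (X\<^sup>2 + Y\<^sup>2 + Z\<^sup>2)" using pY zero_le_power2[of X] zero_le_power2[of Y] zero_le_power2[of Z]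
    unfolding distrib_left by linarith
  finally have "(ucoord (real (m * 2^j + h) * d) x / l)\<^sup>2 \<le> 20 * (X\<^sup>2 + Y\<^sup>2 + Z\<^sup>2)"
    unfolding u p_def q_def by (simp add: mult.assoc)
  then have "exp (- (20 * (X\<^sup>2 + Y\<^sup>2 + Z\<^sup>2))) \<le> exp (- (ucoord (real (m * 2^j + h) * d) x / l)\<^sup>2)" by simp
  also have "\<dots> \<le> 1 / (1 + (ucoord (real (m * 2^j + h) * d) x / l)\<^sup>2)"
    by (rule exp_neg_le_inverse) simp
  finally have *: "exp (- (20 * (X\<^sup>2 + Y\<^sup>2 + Z\<^sup>2))) \<le> 1 / (1 + (ucoord (real (m * 2^j + h) * d) x / l)\<^sup>2)" .
  have k1: "2 * pi / (1/40) = 80 * pi" and k2: "(a + b + c) / (2 * (1/40)) = 20 * (a + b + c)" for a b c :: real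
    by simp_all
  have k3: "sqrt (l\<^sup>2) = l" using l(1) by simp
  have k: "qkernel (1/40) d j m x = sqrt (80 * pi) ^ 3 * d / (l * 2^j) * exp (- (20 * (X\<^sup>2 + Y\<^sup>2 + Z\<^sup>2)))"
    unfolding qkernel_def c_def[symmetric] l_def[symmetric] X_def Y_def Z_def l2[symmetric] power_divide k1 k2 k3
    ..
  show ?thesis unfolding k l_def[symmetric] using d l by (intro mult_left_mono *) auto
qed

text \<open>A point incident to a tube, with \<open>A = O(1)\<close>, receives a fixed multiple of
  \<open>d\<close>, the height of a normalised Gaussian on a box of volume about
  \<open>1 / d\<close>.\<close>

lemma qkernel_ge:
  assumes d: "0 < d" "d \<le> 1" and A: "\<bar>ucoord (real m * d) x\<bar> \<le> A" "\<bar>vcoord (real m * d) x\<bar> \<le> A" "\<bar>d * x $ 3\<bar> \<le> A"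
  shows "d * exp (- (2 * A\<^sup>2)) \<le> qkernel 1 d 0 m x"
proof -
  define l where "l = 1 + d\<^sup>2"
  have l: "1 \<le> l" "l \<le> 2" using d power_le_one[of d 2] by (simp_all add: l_def)
  have sq: "(ucoord (real m * d) x)\<^sup>2 \<le> A\<^sup>2" "(vcoord (real m * d) x)\<^sup>2 \<le> A\<^sup>2" "(d * x $ 3)\<^sup>2 \<le> A\<^sup>2"
    using A by (simp_all add: abs_le_square_iff[symmetric])
  have "(ucoord (real m * d) x)\<^sup>2 / l \<le> (ucoord (real m * d) x)\<^sup>2" using l by (simp add: divide_le_eq mult_le_cancel_left1)
  then have le: "(ucoord (real m * d) x)\<^sup>2 / l + (vcoord (real m * d) x)\<^sup>2 + (d * x $ 3)\<^sup>2 \<le> 4 * A\<^sup>2"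
    using sq zero_le_power2[of A] by linarith
  then have e: "exp (- (2 * A\<^sup>2)) \<le> exp (- (((ucoord (real m * d) x)\<^sup>2 / l + (vcoord (real m * d) x)\<^sup>2 + (d * x $ 3)\<^sup>2) / 2))"
    using sq zero_le_power2[of A] le by simp
  have "sqrt l \<le> 2" using l by (intro real_le_lsqrt) auto
  also have "2 \<le> sqrt (2 * pi) ^ 3"
  proof -
    have "2 \<le> sqrt (2 * pi)" using pi_ge_two by (intro real_le_rsqrt) auto
    then have "2 ^ 3 \<le> sqrt (2 * pi) ^ 3" by (intro power_mono) auto
    then show ?thesis by simp
  qed
  finally have "1 \<le> sqrt (2 * pi) ^ 3 / sqrt l" using l by simp
  from mult_right_mono[OF this, of d] have "d \<le> sqrt (2 * pi) ^ 3 * d / sqrt l" using d by simp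
  then have "d * exp (- (2 * A\<^sup>2)) \<le> sqrt (2 * pi) ^ 3 * d / sqrt l * 
     exp (- (((ucoord (real m * d) x)\<^sup>2 / l + (vcoord (real m * d) x)\<^sup>2 + (d * x $ 3)\<^sup>2) / 2))"
    using d e by (intro mult_mono) auto
  then show ?thesis by (simp add: qkernel_def l_def)
qed

text \<open>The kernel has height about \<open>d / (l * 2^j)\<close>, the arc has \<open>2^j\<close>
  directions, and each contributes at most \<open>B * N * l\<close> by \<open>H\<close>, the form in
  which (S1) enters. Both \<open>l\<close> and \<open>2^j\<close> cancel, so no scale is worse than
  another.\<close>

lemma cluster_energy:
  fixes y :: "'a \<Rightarrow> real^3"
  assumes fin: "finite \<T>" and d: "0 < d" and BN: "0 \<le> B" "0 \<le> N"
    and H: "\<And>k l \<mu>. 1 \<le> l \<Longrightarrow>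
      (\<Sum>T | T \<in> \<T> \<and> n T = k. 1 / (1 + ((ucoord (real k * d) (y T) - \<mu>) / l)\<^sup>2)) \<le> B * N * l"
  shows "(\<Sum>T\<in>dyadic_cluster \<T> n j m. \<Sum>T'\<in>dyadic_cluster \<T> n j m. qkernel (1/40) d j m (y T' - y T))
    \<le> sqrt (80 * pi) ^ 3 * d * B * N * real (card (dyadic_cluster \<T> n j m))"
proof -
  define l where "l = sqrt (1 + (4^j * d)\<^sup>2)"
  have l: "l \<ge> 1" using d by (auto simp: l_def)
  define G where "G = sqrt (80 * pi) ^ 3 * d / (l * 2^j)"
  have G: "G \<ge> 0" using d l by (simp add: G_def)
  define D where "D = dyadic_cluster \<T> n j m"
  have finD: "finite D" using fin by (simp add: D_def dyadic_cluster_def)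
  have one: "(\<Sum>T'\<in>D. qkernel (1/40) d j m (y T' - y T)) \<le> sqrt (80 * pi) ^ 3 * d * B * N" for T
  proof -
    have "(\<Sum>T'\<in>D. qkernel (1/40) d j m (y T' - y T)) \<le>
       (\<Sum>T'\<in>D. G * (1 / (1 + ((ucoord (real (n T') * d) (y T') - ucoord (real (n T') * d) (y T)) / l)\<^sup>2)))"
    proof (rule sum_mono)
      fix T' assume "T' \<in> D"
      then have "n T' = m * 2^j + n T' mod 2^j"
        using div_mult_mod_eq[of "n T'" "2^j"] by (simp add: D_def dyadic_cluster_def)
      then show "qkernel (1/40) d j m (y T' - y T) \<le> G * (1 / (1 + ((ucoord (real (n T') * d) (y T') - ucoord (real (n T') * d) (y T)) / l)\<^sup>2))"
        using qkernel_le[OF d, of "n T' mod 2^j" j m "y T' - y T"]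
        by (simp add: G_def l_def ucoord_diff)
    qed
    also have "\<dots> = G * (\<Sum>T'\<in>D. 1 / (1 + ((ucoord (real (n T') * d) (y T') - ucoord (real (n T') * d) (y T)) / l)\<^sup>2))"
      by (rule sum_distrib_left[symmetric])
    also have "(\<Sum>T'\<in>D. 1 / (1 + ((ucoord (real (n T') * d) (y T') - ucoord (real (n T') * d) (y T)) / l)\<^sup>2)) =
       (\<Sum>k\<in>{m * 2^j..<m * 2^j + 2^j}. \<Sum>T' | T' \<in> D \<and> n T' = k.
          1 / (1 + ((ucoord (real (n T') * d) (y T') - ucoord (real (n T') * d) (y T)) / l)\<^sup>2))"
    proof (rule sum.group[symmetric, OF finD])
      show "n ` D \<subseteq> {m * 2^j..<m * 2^j + 2^j}"
      proof
        fix k assume "k \<in> n ` D"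
        then have "k div 2^j = m" by (auto simp: D_def dyadic_cluster_def)
        then have "k = m * 2^j + k mod 2^j" using div_mult_mod_eq[of k "2^j"] by simp
        moreover have "k mod 2^j < 2^j" by simp
        ultimately show "k \<in> {m * 2^j..<m * 2^j + 2^j}" by (metis atLeastLessThan_iff le_add1 nat_add_left_cancel_less)
      qed
    qed simp
    also have "\<dots> \<le> (\<Sum>k\<in>{m * 2^j..<m * 2^j + 2^j}. B * N * l)"
    proof (rule sum_mono)
      fix k
      have "(\<Sum>T' | T' \<in> D \<and> n T' = k. 1 / (1 + ((ucoord (real (n T') * d) (y T') - ucoord (real (n T') * d) (y T)) / l)\<^sup>2)) \<le>
        (\<Sum>T' | T' \<in> \<T> \<and> n T' = k. 1 / (1 + ((ucoord (real (n T') * d) (y T') - ucoord (real (n T') * d) (y T)) / l)\<^sup>2))"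
        using fin by (intro sum_mono2) (auto simp: D_def dyadic_cluster_def)
      also have "\<dots> = (\<Sum>T' | T' \<in> \<T> \<and> n T' = k. 1 / (1 + ((ucoord (real k * d) (y T') - ucoord (real k * d) (y T)) / l)\<^sup>2))"
        by (intro sum.cong) auto
      also have "\<dots> \<le> B * N * l" by (rule H[OF l])
      finally show "(\<Sum>T' | T' \<in> D \<and> n T' = k. 1 / (1 + ((ucoord (real (n T') * d) (y T') - ucoord (real (n T') * d) (y T)) / l)\<^sup>2)) \<le> B * N * l" .
    qed
    also have "\<dots> = 2^j * (B * N * l)" by simp
    also have "G * (2^j * (B * N * l)) = sqrt (80 * pi) ^ 3 * d * B * N" using l by (simp add: G_def)
    finally show ?thesis using G by (simp add: mult_left_mono)
  qed
  have "(\<Sum>T\<in>D. \<Sum>T'\<in>D. qkernel (1/40) d j m (y T' - y T)) \<le> (\<Sum>T\<in>D. sqrt (80 * pi) ^ 3 * d * B * N)"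
    by (intro sum_mono one)
  then show ?thesis by (simp add: D_def mult_ac)
qed

text \<open>Tested against the wave \<open>M(\<xi>) = \<Sum>q. e\<^sup>i\<^sup>x\<^sup>\<xi>\<close> of the points, the incidence count is an integral over the frequency
  space; the free parameter \<open>t\<close> balances the two sides of the inequality of the means.\<close>

lemma incidence_duality:
  fixes y :: "'a \<Rightarrow> real^3" and x :: "'b \<Rightarrow> real^3"
  assumes fin: "finite \<T>" "finite \<Q>" and d: "0 < d" "d \<le> 1"
    and n: "\<And>T. T \<in> \<T> \<Longrightarrow> n T < 2^J" "\<And>T. T \<in> \<T> \<Longrightarrow> real (n T) * d \<le> 1"
    and BN: "0 \<le> B" "0 \<le> N"
    and H: "\<And>k l \<mu>. 1 \<le> l \<Longrightarrow>
      (\<Sum>T | T \<in> \<T> \<and> n T = k. 1 / (1 + ((ucoord (real k * d) (y T) - \<mu>) / l)\<^sup>2)) \<le> B * N * l"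
    and sep: "\<And>q. q \<in> \<Q> \<Longrightarrow> (\<Sum>q'\<in>\<Q>. \<Prod>i\<in>UNIV. 1 / (1 + ((x q - x q') $ i)\<^sup>2)) \<le> B"
    and t: "t > 0"
  shows "(\<Sum>q\<in>\<Q>. \<Sum>T\<in>\<T>. qkernel 1 d 0 (n T) (x q - y T)) \<le> 10^11 * (4 * pi) * (real (J + 1) * t *
       (sqrt (32000 * pi) ^ 3 * B * real (card \<Q>)) +
       (1 / t) * (real (J + 1) * (sqrt (80 * pi) ^ 3 * d * B * N * real (card \<T>))))"
proof -
  define M where "M \<xi> = (\<Sum>q\<in>\<Q>. cis (phase (x q) \<xi>))" for \<xi>
  define A where "A j m \<xi> = (\<Sum>T\<in>dyadic_cluster \<T> n j m. cis (phase (- y T) \<xi>))" for j m \<xi>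
  define E where "E j m \<xi> = exp (- (qform d j m \<xi> / 80))" for j m \<xi>
  define \<Phi> where "\<Phi> \<xi> = exp (- (((fst (fst \<xi>))\<^sup>2 + (snd (fst \<xi>))\<^sup>2 + (snd \<xi>)\<^sup>2) / 32000))" for \<xi> :: "(real \<times> real) \<times> real"
  define S where "S \<xi> = (\<Sum>T\<in>\<T>. of_real (exp (- (qform d 0 (n T) \<xi> / 2))) * cis (phase (- y T) \<xi>))" for \<xi>
  define RHS where "RHS \<xi> = 10^11 * (4 * pi) * (real (J + 1) * t * (\<Phi> \<xi> * (cmod (M \<xi>))\<^sup>2) +
       (1 / t) * (\<Sum>j\<le>J. \<Sum>m\<in>cluster_ids \<T> n j. E j m \<xi> * (cmod (A j m \<xi>))\<^sup>2))" for \<xi>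
  have MS: "M \<xi> * S \<xi> = (\<Sum>q\<in>\<Q>. \<Sum>T\<in>\<T>. of_real (exp (- (qform d 0 (n T) \<xi> / 2))) * cis (phase (x q - y T) \<xi>))" for \<xi>
    unfolding M_def S_def sum_product
    by (intro sum.cong refl) (simp add: phase_def cis_mult algebra_simps)
  note f1 = fourier_qform[where t=1, OF zero_less_one d(1), unfolded mult_1]
  have HMS: "has_bochner_integral lborel (\<lambda>\<xi>. M \<xi> * S \<xi>) (of_real (\<Sum>q\<in>\<Q>. \<Sum>T\<in>\<T>. qkernel 1 d 0 (n T) (x q - y T)))"
    unfolding MS of_real_sum
    by (intro has_bochner_integral_sum) (simp only: has_bochner_integral_iff f1)
  have IMS: "integrable lborel (\<lambda>\<xi>. M \<xi> * S \<xi>)"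
    using HMS by (rule has_bochner_integral_iff[THEN iffD1, THEN conjunct1])
  have vMS: "(\<integral>\<xi>. M \<xi> * S \<xi> \<partial>lborel) = of_real (\<Sum>q\<in>\<Q>. \<Sum>T\<in>\<T>. qkernel 1 d 0 (n T) (x q - y T))"
    using HMS by (rule has_bochner_integral_integral_eq)
  \<comment> \<open>At \<open>c = 0\<close> the slanted coordinates are the standard ones, which
    makes the isotropic Gaussian an instance of \<open>aniso\<close>; \<open>1/16000\<close> is
    \<open>2/32000\<close>.\<close>
  have ph: "\<Phi> \<xi> = exp (- (aniso 0 (1/16000) (1/16000) (1/16000) \<xi> / 2))" for \<xi>
    by (simp add: \<Phi>_def aniso_def fbeta_def fkappa_def add_divide_distrib)
  define kP where "kP z = sqrt (32000 * pi) ^ 3 * exp (- (8000 * ((z $ 1)\<^sup>2 + (z $ 2)\<^sup>2 + (z $ 3)\<^sup>2)))" for z :: "real^3"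
  have fP: "integrable lborel (\<lambda>\<xi>. of_real (\<Phi> \<xi>) * cis (phase z \<xi>))"
    "(\<integral>\<xi>. of_real (\<Phi> \<xi>) * cis (phase z \<xi>) \<partial>lborel) = of_real (kP z)" for z
  proof -
    have g: "(a / (1/16000) + b / (1/16000) + c / (1/16000)) / 2 = 8000 * (a + b + c)" for a b c :: real by simp
    have "sqrt (2 * pi / (1/16000)) * sqrt (2 * pi / (1/16000)) * sqrt (2 * pi / (1/16000)) *
        exp (- (((ucoord 0 z)\<^sup>2 / (1/16000) + (vcoord 0 z)\<^sup>2 / (1/16000) + (z $ 3)\<^sup>2 / (1/16000)) / 2)) = kP z"
      unfolding g by (simp add: kP_def ucoord_def vcoord_def power3_eq_cube)
    then show "integrable lborel (\<lambda>\<xi>. of_real (\<Phi> \<xi>) * cis (phase z \<xi>))"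
      "(\<integral>\<xi>. of_real (\<Phi> \<xi>) * cis (phase z \<xi>) \<partial>lborel) = of_real (kP z)"
      using fourier_aniso[of "1/16000" "1/16000" "1/16000" 0 z] unfolding ph by simp_all
  qed
  note sP = fourier_sum_square[OF fP, of x \<Q>, folded M_def]
  have fE: "integrable lborel (\<lambda>\<xi>. of_real (E j m \<xi>) * cis (phase z \<xi>))"
    "(\<integral>\<xi>. of_real (E j m \<xi>) * cis (phase z \<xi>) \<partial>lborel) = of_real (qkernel (1/40) d j m z)" for j m z
    using fourier_qform[of "1/40" d j m z] d by (simp_all add: E_def)
  note sE = fourier_sum_square[OF fE, where y = "\<lambda>T. - y T", folded A_def]
  have sE': "integrable lborel (\<lambda>\<xi>. E j m \<xi> * (cmod (A j m \<xi>))\<^sup>2)"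
    "(\<integral>\<xi>. E j m \<xi> * (cmod (A j m \<xi>))\<^sup>2 \<partial>lborel) =
       (\<Sum>T\<in>dyadic_cluster \<T> n j m. \<Sum>T'\<in>dyadic_cluster \<T> n j m. qkernel (1/40) d j m (y T' - y T))" for j m
    using sE[of j m "dyadic_cluster \<T> n j m"] by (simp_all add: A_def)
  have HR: "has_bochner_integral lborel RHS (10^11 * (4 * pi) * (real (J + 1) * t * (\<Sum>q\<in>\<Q>. \<Sum>q'\<in>\<Q>. kP (x q - x q')) +
       (1 / t) * (\<Sum>j\<le>J. \<Sum>m\<in>cluster_ids \<T> n j. \<Sum>T\<in>dyadic_cluster \<T> n j m. \<Sum>T'\<in>dyadic_cluster \<T> n j m. qkernel (1/40) d j m (y T' - y T))))"
    unfolding RHS_def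
    by (rule has_bochner_integral_mult_right, rule has_bochner_integral_add; rule has_bochner_integral_mult_right)
      (use sP in \<open>simp add: has_bochner_integral_iff\<close>, rule has_bochner_integral_sum, rule has_bochner_integral_sum,
        simp only: has_bochner_integral_iff sE')
  have IR: "integrable lborel RHS" using HR by (rule has_bochner_integral_iff[THEN iffD1, THEN conjunct1])
  note vR = has_bochner_integral_integral_eq[OF HR]
  have "(\<Sum>q\<in>\<Q>. \<Sum>T\<in>\<T>. qkernel 1 d 0 (n T) (x q - y T)) = (\<integral>\<xi>. Re (M \<xi> * S \<xi>) \<partial>lborel)"
    using integral_Re[OF IMS] vMS by simp
  also have "\<dots> \<le> (\<integral>\<xi>. RHS \<xi> \<partial>lborel)"
  proof (rule integral_mono[OF integrable_Re[OF IMS] IR])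
    fix \<xi>
    have "Re (M \<xi> * S \<xi>) \<le> cmod (M \<xi> * S \<xi>)" by (rule complex_Re_le_cmod)
    also have "\<dots> \<le> RHS \<xi>"
      unfolding S_def RHS_def \<Phi>_def A_def E_def by (rule multiscale_pointwise[OF fin(1) d n t])
    finally show "Re (M \<xi> * S \<xi>) \<le> RHS \<xi>" .
  qed
  also have "\<dots> \<le> 10^11 * (4 * pi) * (real (J + 1) * t * (\<Sum>q\<in>\<Q>. sqrt (32000 * pi) ^ 3 * B) +
       (1 / t) * (\<Sum>j\<le>J. \<Sum>m\<in>cluster_ids \<T> n j. sqrt (80 * pi) ^ 3 * d * B * N * real (card (dyadic_cluster \<T> n j m))))"
  proof -
    have 1: "(\<Sum>q'\<in>\<Q>. kP (x q - x q')) \<le> sqrt (32000 * pi) ^ 3 * B" if "q \<in> \<Q>" for q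
    proof -
      have "(\<Sum>q'\<in>\<Q>. kP (x q - x q')) \<le> (\<Sum>q'\<in>\<Q>. sqrt (32000 * pi) ^ 3 * (\<Prod>i\<in>UNIV. 1 / (1 + ((x q - x q') $ i)\<^sup>2)))"
        unfolding kP_def by (intro sum_mono mult_left_mono exp_norm_square_le) auto
      also have "\<dots> \<le> sqrt (32000 * pi) ^ 3 * B"
        unfolding sum_distrib_left[symmetric] using sep[OF that] by (intro mult_left_mono) auto
      finally show ?thesis .
    qed
    have 2: "(\<Sum>j\<le>J. \<Sum>m\<in>cluster_ids \<T> n j. \<Sum>T\<in>dyadic_cluster \<T> n j m. \<Sum>T'\<in>dyadic_cluster \<T> n j m. qkernel (1/40) d j m (y T' - y T)) \<le>
       (\<Sum>j\<le>J. \<Sum>m\<in>cluster_ids \<T> n j. sqrt (80 * pi) ^ 3 * d * B * N * real (card (dyadic_cluster \<T> n j m)))"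
      by (rule sum_mono, rule sum_mono, rule cluster_energy[OF fin(1) d(1) BN H])
    show ?thesis unfolding vR
    proof (intro mult_left_mono[OF add_mono[OF mult_left_mono mult_left_mono]])
      show "(\<Sum>q\<in>\<Q>. \<Sum>q'\<in>\<Q>. kP (x q - x q')) \<le> (\<Sum>q\<in>\<Q>. sqrt (32000 * pi) ^ 3 * B)"
        by (rule sum_mono, rule 1)
    qed (use 2 t in simp_all)
  qed
  \<comment> \<open>The clusters of one scale partition the tubes, so their sizes add up to the same
    total at every scale.\<close>
  also have "(\<Sum>j\<le>J. \<Sum>m\<in>cluster_ids \<T> n j. sqrt (80 * pi) ^ 3 * d * B * N * real (card (dyadic_cluster \<T> n j m))) =
     (\<Sum>j\<le>J. sqrt (80 * pi) ^ 3 * d * B * N * real (card \<T>))"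
  proof (rule sum.cong[OF refl])
    fix j
    have "(\<Sum>m\<in>cluster_ids \<T> n j. \<Sum>T\<in>dyadic_cluster \<T> n j m. (1::real)) = (\<Sum>T\<in>\<T>. 1)"
      by (rule sum_clusters[OF fin(1)])
    then have "(\<Sum>m\<in>cluster_ids \<T> n j. real (card (dyadic_cluster \<T> n j m))) = real (card \<T>)" by simp
    then show "(\<Sum>m\<in>cluster_ids \<T> n j. sqrt (80 * pi) ^ 3 * d * B * N * real (card (dyadic_cluster \<T> n j m))) = sqrt (80 * pi) ^ 3 * d * B * N * real (card \<T>)"
      by (simp only: sum_distrib_left[symmetric])
  qed
  also have "\<dots> = real (J + 1) * (sqrt (80 * pi) ^ 3 * d * B * N * real (card \<T>))" by simp
  also have "(\<Sum>q\<in>\<Q>. sqrt (32000 * pi) ^ 3 * B) = sqrt (32000 * pi) ^ 3 * B * real (card \<Q>)" by simp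
  finally show ?thesis .
qed

definition incidence_const :: "real \<Rightarrow> real \<Rightarrow> real" where
  "incidence_const A B = 4 * (10^11 * (4 * pi))\<^sup>2 * sqrt (32000 * pi) ^ 3 * sqrt (80 * pi) ^ 3 * B\<^sup>2 * exp (4 * A\<^sup>2)"

text \<open>The number of points occurs linearly on both sides of \<open>incidence_duality\<close>,
  so a \<open>t\<close> proportional to \<open>r\<close> and independent of that number absorbs it
  on the left. The remaining term carries \<open>1 / t\<close>, which supplies the second factor
  \<open>1 / r\<close>.\<close>

lemma incidence_bound:
  fixes y :: "'a \<Rightarrow> real^3" and x :: "'b \<Rightarrow> real^3"
  assumes fin: "finite \<T>" "finite \<Q>" and d: "0 < d" "d \<le> 1"
    and n: "\<And>T. T \<in> \<T> \<Longrightarrow> n T < 2^J" "\<And>T. T \<in> \<T> \<Longrightarrow> real (n T) * d \<le> 1"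
    and BN: "0 < B" "0 \<le> N" and r: "0 < r"
    and H: "\<And>k l \<mu>. 1 \<le> l \<Longrightarrow>
      (\<Sum>T | T \<in> \<T> \<and> n T = k. 1 / (1 + ((ucoord (real k * d) (y T) - \<mu>) / l)\<^sup>2)) \<le> B * N * l"
    and sep: "\<And>q. q \<in> \<Q> \<Longrightarrow> (\<Sum>q'\<in>\<Q>. \<Prod>i\<in>UNIV. 1 / (1 + ((x q - x q') $ i)\<^sup>2)) \<le> B"
    and rich: "\<And>q. q \<in> \<Q> \<Longrightarrow> r \<le> real (card {T \<in> \<T>. \<bar>ucoord (real (n T) * d) (x q - y T)\<bar> \<le> A \<and>
      \<bar>vcoord (real (n T) * d) (x q - y T)\<bar> \<le> A \<and> \<bar>d * (x q - y T) $ 3\<bar> \<le> A})"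
  shows "real (card \<Q>) \<le> incidence_const A B * (real (J + 1))\<^sup>2 * (real (card \<T>) * N / (d * r\<^sup>2))"
proof -
  define C1 C2 C3 e j where "C1 = 10^11 * (4 * pi)" and "C2 = sqrt (32000 * pi) ^ 3" and "C3 = sqrt (80 * pi) ^ 3"
    and "e = exp (- (2 * A\<^sup>2))" and "j = real (J + 1)"
  have pos: "C1 > 0" "C2 > 0" "C3 > 0" "e > 0" "j > 0" by (simp_all add: C1_def C2_def C3_def e_def j_def)
  \<comment> \<open>Makes the first term on the right exactly half of the lower bound
    \<open>c * r * d * e\<close>.\<close>
  define t where "t = r * d * e / (2 * C1 * C2 * B * j)"
  have t: "t > 0" using pos BN r d by (simp add: t_def)
  define c where "c = real (card \<Q>)"
  have "r * (d * e) \<le> (\<Sum>T\<in>\<T>. qkernel 1 d 0 (n T) (x q - y T))" if "q \<in> \<Q>" for q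
  proof -
    define G where "G = {T \<in> \<T>. \<bar>ucoord (real (n T) * d) (x q - y T)\<bar> \<le> A \<and>
      \<bar>vcoord (real (n T) * d) (x q - y T)\<bar> \<le> A \<and> \<bar>d * (x q - y T) $ 3\<bar> \<le> A}"
    have "r * (d * e) \<le> real (card G) * (d * e)"
      using rich[OF that] d pos unfolding G_def by (intro mult_right_mono) auto
    also have "\<dots> = (\<Sum>T\<in>G. d * e)" by simp
    also have "\<dots> \<le> (\<Sum>T\<in>G. qkernel 1 d 0 (n T) (x q - y T))"
      unfolding e_def by (intro sum_mono qkernel_ge d) (auto simp: G_def)
    also have "\<dots> \<le> (\<Sum>T\<in>\<T>. qkernel 1 d 0 (n T) (x q - y T))"
      using fin d by (intro sum_mono2) (auto simp: G_def qkernel_def)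
    finally show ?thesis .
  qed
  then have "(\<Sum>q\<in>\<Q>. r * (d * e)) \<le> (\<Sum>q\<in>\<Q>. \<Sum>T\<in>\<T>. qkernel 1 d 0 (n T) (x q - y T))"
    by (rule sum_mono)
  also have "\<dots> \<le> C1 * (j * t * (C2 * B * c) + (1 / t) * (j * (C3 * d * B * N * real (card \<T>))))"
    unfolding C1_def C2_def C3_def j_def c_def using BN
    by (intro incidence_duality[OF fin d n _ _ H sep t]) auto
  finally have "c * r * d * e \<le> C1 * C2 * B * j * c * t + C1 * C3 * j * d * B * N * real (card \<T>) / t"
    by (simp add: c_def algebra_simps)
  also have "C1 * C2 * B * j * c * t = c * r * d * e / 2"
    using pos BN by (simp add: t_def)
  finally have "c * r * d * e \<le> 2 * (C1 * C3 * j * d * B * N * real (card \<T>) / t)" by linarith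
  also have "\<dots> = 4 * C1\<^sup>2 * C2 * C3 * B\<^sup>2 * j\<^sup>2 * N * real (card \<T>) / (r * e)"
    using pos BN d r by (simp add: t_def power2_eq_square)
  finally have "c \<le> 4 * C1\<^sup>2 * C2 * C3 * B\<^sup>2 * j\<^sup>2 * N * real (card \<T>) / (r * e) / (r * d * e)"
    using pos d r by (simp add: pos_le_divide_eq mult_ac)
  also have "\<dots> = (4 * C1\<^sup>2 * C2 * C3 * B\<^sup>2 * (1 / e)\<^sup>2) * j\<^sup>2 * (real (card \<T>) * N / (d * r\<^sup>2))"
    using pos d r by (simp add: field_simps power2_eq_square)
  also have "(1 / e)\<^sup>2 = exp (4 * A\<^sup>2)"
    by (simp add: e_def exp_minus inverse_eq_divide power2_eq_square mult_exp_exp)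
  finally show ?thesis by (simp add: incidence_const_def C1_def C2_def C3_def j_def c_def)
qed

section \<open>The Frenet frame\<close>

lemma moment_curve_axis: "moment_curve = (\<lambda>t. t *\<^sub>R axis 1 1 + t^2 *\<^sub>R axis 2 1 + t^3 *\<^sub>R axis 3 1)"
  by (auto simp: moment_curve_def vec_eq_iff forall_3 axis_def)

definition velocity :: "real \<Rightarrow> real^3" where
  "velocity c = vector [1, 2 * c, 3 * c^2]"

definition acceleration :: "real \<Rightarrow> real^3" where
  "acceleration c = vector [0, 2, 6 * c]"

definition tangent_deriv :: "real \<Rightarrow> real^3" where
  "tangent_deriv c = inverse (norm (velocity c)) *\<^sub>R acceleration c -
     ((velocity c \<bullet> acceleration c) / norm (velocity c) ^ 3) *\<^sub>R velocity c"

lemma velocity_axis: "velocity = (\<lambda>c. axis 1 1 + (2 * c) *\<^sub>R axis 2 1 + (3 * c^2) *\<^sub>R axis 3 1)"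
  by (auto simp: velocity_def vec_eq_iff forall_3 axis_def)

lemma acceleration_axis: "acceleration = (\<lambda>c. 2 *\<^sub>R axis 2 1 + (6 * c) *\<^sub>R axis 3 1)"
  by (auto simp: acceleration_def vec_eq_iff forall_3 axis_def)

lemma moment_curve_has_derivative: "(moment_curve has_vector_derivative velocity c) (at c)"
  unfolding moment_curve_axis velocity_axis
  by (auto intro!: derivative_eq_intros simp: has_real_derivative_iff_has_vector_derivative[symmetric])

lemma velocity_has_derivative: "(velocity has_vector_derivative acceleration c) (at c)"
  unfolding velocity_axis acceleration_axis
  by (auto intro!: derivative_eq_intros simp: has_real_derivative_iff_has_vector_derivative[symmetric])

lemma norm_velocity: "norm (velocity c) = sqrt (1 + 4 * c^2 + 9 * c^4)"
  by (simp add: norm_eq_sqrt_inner inner_vec_def sum_3 velocity_def power2_eq_square power4_eq_xxxx)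

lemma velocity_pos: "norm (velocity c) \<ge> 1"
  by (simp add: norm_velocity)

lemma norm_velocity_inverse: "norm (velocity c) * inverse (norm (velocity c)) = 1"
  "inverse (norm (velocity c)) * norm (velocity c) = 1"
  using velocity_pos[of c] by (simp_all del: norm_eq_zero)

lemma tangent_eq: "tangent c = inverse (norm (velocity c)) *\<^sub>R velocity c"
  using vector_derivative_at[OF moment_curve_has_derivative] by (simp add: tangent_def sgn_div_norm)

lemma tangent_has_derivative: "(tangent has_vector_derivative tangent_deriv c) (at c)"
proof -
  define D where "D = 1 + 4 * c^2 + 9 * c^4"
  have D: "D > 0" by (simp add: D_def add_pos_nonneg)
  have "((\<lambda>c. inverse (sqrt (1 + 4 * c^2 + 9 * c^4))) has_real_derivative
      - ((8 * c + 36 * c^3) / (2 * sqrt D)) / (sqrt D)^2) (at c)"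
    using D unfolding D_def
    by (auto intro!: derivative_eq_intros simp: field_simps power2_eq_square)
  moreover have "- ((8 * c + 36 * c^3) / (2 * sqrt D)) / (sqrt D)^2 =
      - ((velocity c \<bullet> acceleration c) / norm (velocity c) ^ 3)"
  proof -
    have va: "velocity c \<bullet> acceleration c = 4 * c + 18 * c^3"
      by (simp add: inner_vec_def sum_3 velocity_def acceleration_def power2_eq_square power3_eq_cube)
    have g: "- (2 * a / (2 * s)) / s^2 = - (a / s^3)" for a s :: real
      by (simp add: power2_eq_square power3_eq_cube)
    show ?thesis unfolding va norm_velocity D_def[symmetric] g[symmetric] by simp
  qed
  ultimately have "((\<lambda>c. inverse (norm (velocity c))) has_real_derivative
      - ((velocity c \<bullet> acceleration c) / norm (velocity c) ^ 3)) (at c)"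
    by (simp add: norm_velocity)
  from has_vector_derivative_scaleR[OF this velocity_has_derivative]
  show ?thesis unfolding tangent_eq[abs_def] tangent_deriv_def by (simp add: has_vector_derivative_def)
qed

lemma normal_eq: "normal c = inverse (norm (tangent_deriv c)) *\<^sub>R tangent_deriv c"
  using vector_derivative_at[OF tangent_has_derivative] by (simp add: normal_def sgn_div_norm)

text \<open>\<open>normal\<close> is a \<open>sgn\<close>, hence a unit vector only because of this.
  Velocity and acceleration have first entries 1 and 0 and are independent.\<close>

lemma tangent_deriv_nonzero: "tangent_deriv c \<noteq> 0"
proof
  assume z: "tangent_deriv c = 0"
  define k where "k = (velocity c \<bullet> acceleration c) / norm (velocity c) ^ 3"
  have "tangent_deriv c $ 1 = - k" "tangent_deriv c $ 2 = 2 * inverse (norm (velocity c)) - k * (2 * c)"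
    by (simp_all add: tangent_deriv_def k_def velocity_def acceleration_def)
  then show False using z velocity_pos[of c] by simp
qed

lemma tangent_orthogonal_deriv: "tangent c \<bullet> tangent_deriv c = 0"
proof -
  have "velocity c \<bullet> velocity c = norm (velocity c) ^ 2" by (simp add: power2_norm_eq_inner)
  then have "velocity c \<bullet> tangent_deriv c = 0"
    using velocity_pos[of c] by (simp add: tangent_deriv_def inner_diff_right field_simps power2_eq_square power3_eq_cube)
  then show ?thesis by (simp add: tangent_eq)
qed

lemma frenet_orthonormal:
  "tangent c \<bullet> tangent c = 1" "normal c \<bullet> normal c = 1" "binormal c \<bullet> binormal c = 1"
  "tangent c \<bullet> normal c = 0" "tangent c \<bullet> binormal c = 0" "normal c \<bullet> binormal c = 0"
  "normal c \<bullet> tangent c = 0" "binormal c \<bullet> tangent c = 0" "binormal c \<bullet> normal c = 0"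
proof -
  have 1: "norm (tangent c) = 1" by (simp add: tangent_eq norm_velocity_inverse)
  have 2: "norm (normal c) = 1" using tangent_deriv_nonzero[of c] by (simp add: normal_eq)
  show 3: "tangent c \<bullet> normal c = 0" by (simp add: normal_eq tangent_orthogonal_deriv)
  have "(norm (binormal c))\<^sup>2 = 1"
    unfolding binormal_def norm_cross using 1 2 3 by simp
  then show "binormal c \<bullet> binormal c = 1" by (simp add: power2_norm_eq_inner)
  show "tangent c \<bullet> tangent c = 1" "normal c \<bullet> normal c = 1" using 1 2 by (simp_all add: norm_eq_1)
  show "tangent c \<bullet> binormal c = 0" "normal c \<bullet> binormal c = 0"
    "binormal c \<bullet> tangent c = 0" "binormal c \<bullet> normal c = 0"
    by (simp_all add: binormal_def dot_cross_self)
  show "normal c \<bullet> tangent c = 0" using 3 by (simp add: inner_commute)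
qed

text \<open>A vector orthogonal to the frame has zero cross product with \<open>binormal c\<close>,
  by the triple product formula, and zero inner product with it; so it vanishes.\<close>

lemma frenet_expansion:
  "x = (x \<bullet> tangent c) *\<^sub>R tangent c + (x \<bullet> normal c) *\<^sub>R normal c + (x \<bullet> binormal c) *\<^sub>R binormal c"
proof -
  define y where "y = x - ((x \<bullet> tangent c) *\<^sub>R tangent c + (x \<bullet> normal c) *\<^sub>R normal c + (x \<bullet> binormal c) *\<^sub>R binormal c)"
  have y: "y \<bullet> tangent c = 0" "y \<bullet> normal c = 0" "y \<bullet> binormal c = 0"
    by (simp_all add: y_def inner_diff_left inner_add_left frenet_orthonormal)
  have "cross3 y (binormal c) = 0"
    unfolding binormal_def Lagrange by (simp add: y)
  then have "(norm y * norm (binormal c))\<^sup>2 = 0"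
    using norm_cross[of y "binormal c"] y(3) by simp
  moreover have "norm (binormal c) = 1" by (simp add: norm_eq_1 frenet_orthonormal)
  ultimately have "y = 0" by simp
  then show ?thesis by (simp add: y_def)
qed

lemma norm_le_frenet: "norm x \<le> \<bar>x \<bullet> tangent c\<bar> + \<bar>x \<bullet> normal c\<bar> + \<bar>x \<bullet> binormal c\<bar>"
proof -
  have n: "norm (tangent c) = 1" "norm (normal c) = 1" "norm (binormal c) = 1"
    by (simp_all add: norm_eq_1 frenet_orthonormal)
  have "norm x = norm ((x \<bullet> tangent c) *\<^sub>R tangent c + (x \<bullet> normal c) *\<^sub>R normal c + (x \<bullet> binormal c) *\<^sub>R binormal c)"
    using frenet_expansion[of x c] by simp
  also have "\<dots> \<le> norm ((x \<bullet> tangent c) *\<^sub>R tangent c) + norm ((x \<bullet> normal c) *\<^sub>R normal c) + norm ((x \<bullet> binormal c) *\<^sub>R binormal c)"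
    by (intro norm_triangle_le add_mono order_refl norm_triangle_ineq)
  finally show ?thesis by (simp add: n)
qed

lemma abs_inner_frenet_le:
  "\<bar>x \<bullet> tangent c\<bar> \<le> norm x" "\<bar>x \<bullet> normal c\<bar> \<le> norm x" "\<bar>x \<bullet> binormal c\<bar> \<le> norm x"
proof -
  have n: "norm (tangent c) = 1" "norm (normal c) = 1" "norm (binormal c) = 1"
    by (simp_all add: norm_eq_1 frenet_orthonormal)
  show "\<bar>x \<bullet> tangent c\<bar> \<le> norm x" "\<bar>x \<bullet> normal c\<bar> \<le> norm x" "\<bar>x \<bullet> binormal c\<bar> \<le> norm x"
    using Cauchy_Schwarz_ineq2[of x] by (metis mult.right_neutral n)+
qed

lemma ucoord_tangent: "ucoord c x = norm (velocity c) * (x \<bullet> tangent c)"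
proof -
  have "norm (velocity c) * (x \<bullet> tangent c) = (norm (velocity c) * inverse (norm (velocity c))) * (x \<bullet> velocity c)"
    by (simp add: tangent_eq)
  then show ?thesis unfolding norm_velocity_inverse
    by (simp add: ucoord_def inner_vec_def sum_3 velocity_def algebra_simps)
qed

lemma velocity_le:
  assumes "0 \<le> c" "c \<le> 1"
  shows "norm (velocity c) \<le> 4"
proof -
  have "1 + 4 * c^2 + 9 * c^4 \<le> 4\<^sup>2" using assms power_le_one[of c 2] power_le_one[of c 4] by simp
  then show ?thesis unfolding norm_velocity by (intro real_le_lsqrt) auto
qed

text \<open>\<open>2 * vcoord c x\<close> is the pairing of \<open>x\<close> with the acceleration,
  which has no binormal component; therefore the long side of a tube does not enter.\<close>

lemma vcoord_frenet:
  assumes "0 \<le> c" "c \<le> 1"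
  shows "\<bar>vcoord c x\<bar> \<le> 4 * (\<bar>x \<bullet> tangent c\<bar> + \<bar>x \<bullet> normal c\<bar>)"
proof -
  define a where "a = acceleration c"
  have td: "acceleration c = norm (velocity c) *\<^sub>R (tangent_deriv c + ((velocity c \<bullet> acceleration c) / norm (velocity c) ^ 3) *\<^sub>R velocity c)"
    by (simp add: tangent_deriv_def norm_velocity_inverse)
  have "binormal c \<bullet> velocity c = norm (velocity c) * (binormal c \<bullet> tangent c)"
    by (simp add: tangent_eq mult.assoc[symmetric] norm_velocity_inverse)
  moreover have "binormal c \<bullet> tangent_deriv c = norm (tangent_deriv c) * (binormal c \<bullet> normal c)"
    using tangent_deriv_nonzero[of c] by (simp add: normal_eq)
  ultimately have "binormal c \<bullet> acceleration c = 0"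
    by (subst td) (simp add: inner_add_right frenet_orthonormal)
  then have ab: "a \<bullet> binormal c = 0" by (simp add: inner_commute a_def)
  have "norm a \<le> (\<Sum>i\<in>UNIV. \<bar>a $ i\<bar>)" by (rule norm_le_l1_cart)
  also have "\<dots> \<le> 8" using assms by (simp add: a_def sum_3 acceleration_def)
  finally have a8: "norm a \<le> 8" .
  have "2 * vcoord c x = x \<bullet> a"
    by (simp add: vcoord_def a_def inner_vec_def sum_3 acceleration_def)
  also have "\<dots> = (a \<bullet> tangent c) * (x \<bullet> tangent c) + (a \<bullet> normal c) * (x \<bullet> normal c)"
    by (subst frenet_expansion[of a c]) (simp add: inner_add_right ab)
  finally have "2 * \<bar>vcoord c x\<bar> \<le> \<bar>a \<bullet> tangent c\<bar> * \<bar>x \<bullet> tangent c\<bar> + \<bar>a \<bullet> normal c\<bar> * \<bar>x \<bullet> normal c\<bar>"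
    unfolding abs_mult[symmetric] by linarith
  also have "\<dots> \<le> 8 * \<bar>x \<bullet> tangent c\<bar> + 8 * \<bar>x \<bullet> normal c\<bar>"
    using abs_inner_frenet_le[of a c] a8 by (intro add_mono mult_right_mono) auto
  finally show ?thesis by simp
qed

section \<open>Packing of plates, tubes and cubes\<close>

lemma sum_fibers_le:
  fixes \<phi> :: "'b \<Rightarrow> real"
  assumes A: "finite A" and m: "\<And>b. real (card {a \<in> A. f a = b}) \<le> m" and \<phi>: "\<And>b. \<phi> b \<ge> 0"
  shows "(\<Sum>a\<in>A. \<phi> (f a)) \<le> m * (\<Sum>b\<in>f ` A. \<phi> b)"
proof -
  have "(\<Sum>a\<in>A. \<phi> (f a)) = (\<Sum>b\<in>f ` A. \<Sum>a | a \<in> A \<and> f a = b. \<phi> (f a))"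
    using A by (intro sum.group[symmetric]) auto
  also have "\<dots> = (\<Sum>b\<in>f ` A. real (card {a \<in> A. f a = b}) * \<phi> b)"
    by (intro sum.cong refl) simp
  also have "\<dots> \<le> (\<Sum>b\<in>f ` A. m * \<phi> b)"
    using m \<phi> by (intro sum_mono mult_right_mono)
  finally show ?thesis by (simp add: sum_distrib_left)
qed

definition frenet_point :: "real \<Rightarrow> real \<Rightarrow> real \<Rightarrow> real \<Rightarrow> int \<Rightarrow> int \<Rightarrow> int \<Rightarrow> real^3" where
  "frenet_point c s1 s2 s3 i j l =
     (of_int i * s1) *\<^sub>R tangent c + (of_int j * s2) *\<^sub>R normal c + (of_int l * s3) *\<^sub>R binormal c"

lemma frenet_point_inner:
  "frenet_point c s1 s2 s3 i j l \<bullet> tangent c = of_int i * s1"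
  "frenet_point c s1 s2 s3 i j l \<bullet> normal c = of_int j * s2"
  "frenet_point c s1 s2 s3 i j l \<bullet> binormal c = of_int l * s3"
  by (simp_all add: frenet_point_def inner_add_left frenet_orthonormal)

text \<open>The grid spacing equals the sides of the inner box, so rounding the centre stays inside
  the set. Since bounded overlap limits the sets through one point, counting boxes becomes counting
  grid points.\<close>

lemma essentially_frenet_box_grid:
  assumes B: "essentially_frenet_box K c l1 l2 l3 B" and K: "K \<ge> 1" and l: "l1 > 0" "l2 > 0" "l3 > 0"
  obtains p i j k where "p \<in> B" "B \<subseteq> frenet_box c p (K * l1) (K * l2) (K * l3)"
    "frenet_point c (l1 / K) (l2 / K) (l3 / K) i j k \<in> B"
    "\<bar>of_int i * (l1 / K) - p \<bullet> tangent c\<bar> \<le> l1 / K / 2"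
    "\<bar>of_int j * (l2 / K) - p \<bullet> normal c\<bar> \<le> l2 / K / 2"
    "\<bar>of_int k * (l3 / K) - p \<bullet> binormal c\<bar> \<le> l3 / K / 2"
proof -
  obtain p where p: "frenet_box c p (l1 / K) (l2 / K) (l3 / K) \<subseteq> B" "B \<subseteq> frenet_box c p (K * l1) (K * l2) (K * l3)"
    using B unfolding essentially_frenet_box_def by auto
  have pos: "l1 / K > 0" "l2 / K > 0" "l3 / K > 0" using l K by simp_all
  have rd: "\<bar>of_int (round (a / s)) * s - a\<bar> \<le> s / 2" if "s > 0" for a s :: real
  proof -
    have "\<bar>of_int (round (a / s)) * s - a\<bar> = \<bar>of_int (round (a / s)) - a / s\<bar> * s"
    proof -
      have "of_int (round (a / s)) * s - a = (of_int (round (a / s)) - a / s) * s" using that by (simp add: left_diff_distrib)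
      then show ?thesis using that by (simp add: abs_mult)
    qed
    also have "\<dots> \<le> 1/2 * s" using that of_int_round_abs_le[of "a / s"] by (intro mult_right_mono) auto
    finally show ?thesis by simp
  qed
  note r = rd[OF pos(1), of "p \<bullet> tangent c"] rd[OF pos(2), of "p \<bullet> normal c"] rd[OF pos(3), of "p \<bullet> binormal c"]
  have "p \<in> frenet_box c p (l1 / K) (l2 / K) (l3 / K)" using pos by (simp add: frenet_box_def)
  moreover have "frenet_point c (l1 / K) (l2 / K) (l3 / K) (round (p \<bullet> tangent c / (l1 / K)))
      (round (p \<bullet> normal c / (l2 / K))) (round (p \<bullet> binormal c / (l3 / K))) \<in> frenet_box c p (l1 / K) (l2 / K) (l3 / K)"
    unfolding frenet_box_def mem_Collect_eq inner_diff_left frenet_point_inner using r by blast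
  ultimately show ?thesis using that p r by blast
qed

lemma norm_big_cube:
  assumes "x \<in> big_cube R"
  shows "norm x \<le> 3 * R"
proof -
  have "norm x \<le> (\<Sum>i\<in>UNIV. \<bar>x $ i\<bar>)" by (rule norm_le_l1_cart)
  also have "\<dots> \<le> (\<Sum>i\<in>(UNIV::3 set). R)" using assms by (intro sum_mono) (simp add: big_cube_def)
  finally show ?thesis by simp
qed

lemma powr_two_thirds:
  fixes R :: real
  assumes "R \<ge> 1"
  shows "R powr (2/3) > 0" "R powr (2/3) \<le> R" "R powr (-1/3) > 0" "R powr (-1/3) \<le> 1"
    "R powr (-1/3) * R = R powr (2/3)" "R powr (1/3) = 1 / R powr (-1/3)"
proof -
  show "R powr (2/3) \<le> R" using powr_mono[of "2/3" 1 R] assms by simp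
  show "R powr (-1/3) \<le> 1" using powr_mono[of "-1/3" 0 R] assms by simp
  have "R powr (-1/3) * R powr 1 = R powr (2/3)" unfolding powr_add[symmetric] by simp
  then show "R powr (-1/3) * R = R powr (2/3)" using assms by simp
  show "R powr (1/3) = 1 / R powr (-1/3)" using assms by (simp add: powr_minus_divide)
qed (use assms in simp_all)

lemma finite_partition_points:
  assumes "R \<ge> 1"
  shows "finite (partition_points R)"
proof -
  define d where "d = R powr (-1/3)"
  have d: "d > 0" using powr_two_thirds[OF assms] by (simp add: d_def)
  have "partition_points R \<subseteq> (\<lambda>k. real k * d) ` {..nat \<lceil>1 / d\<rceil>}"
  proof
    fix c assume "c \<in> partition_points R"
    then obtain k :: nat where k: "c = real k * d" "c < 1" by (auto simp: partition_points_def d_def)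
    then have "real k < 1 / d" using d by (simp add: pos_less_divide_eq)
    then have "k \<le> nat \<lceil>1 / d\<rceil>" by linarith
    then show "c \<in> (\<lambda>k. real k * d) ` {..nat \<lceil>1 / d\<rceil>}" using k by blast
  qed
  then show ?thesis by (rule finite_subset) simp
qed

text \<open>\<open>card\<close> is 0 on infinite sets, so the cardinalities in the hypotheses are
  true counts only after this. Each tube contains one of finitely many grid points, and each point
  lies in finitely many tubes of one direction.\<close>

lemma finite_separated_tubes:
  assumes K: "K \<ge> 1" and R: "R \<ge> 1" and sep: "separated_vinogradov_tubes K R \<T> dir"
  shows "finite \<T>"
proof -
  define \<rho> where "\<rho> = R powr (2/3)"
  note \<rho> = powr_two_thirds(1,2)[OF R, folded \<rho>_def]
  have R0: "R > 0" using R by simp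
  define m where "m = \<lceil>3 * R * K / \<rho>\<rceil>"
  define P where "P c i j k = frenet_point c (\<rho> / K) (\<rho> / K) (R / K) i j k" for c i j k
  have "\<T> \<subseteq> (\<Union>c\<in>partition_points R. \<Union>i\<in>{-m..m}. \<Union>j\<in>{-m..m}. \<Union>k\<in>{-m..m}. {T \<in> tubes_of \<T> dir c. P c i j k \<in> T})"
  proof
    fix T assume T: "T \<in> \<T>"
    define c where "c = dir T"
    have c: "c \<in> partition_points R" "vinogradov_tube K R c T" "T \<subseteq> big_cube R"
      using sep T by (auto simp: separated_vinogradov_tubes_def c_def)
    obtain p i j k where P: "P c i j k \<in> T"
      unfolding P_def
      by (rule essentially_frenet_box_grid[OF c(2)[unfolded vinogradov_tube_def, folded \<rho>_def] K \<rho>(1) \<rho>(1) R0]) blast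
    then have n: "norm (P c i j k) \<le> 3 * R" using c(3) norm_big_cube by blast
    have bd: "i' \<in> {-m..m}" if "\<bar>of_int i' * (s / K)\<bar> \<le> 3 * R" "\<rho> \<le> s" for i' s
    proof -
      have "\<bar>of_int i'\<bar> * (\<rho> / K) \<le> \<bar>of_int i'\<bar> * (s / K)" using that(2) K by (intro mult_left_mono divide_right_mono) auto
      also have "\<dots> \<le> 3 * R" using that \<rho> K by (simp add: abs_mult)
      finally have "\<bar>of_int i'\<bar> \<le> 3 * R * K / \<rho>" using \<rho> K by (simp add: field_simps)
      then have "of_int \<bar>i'\<bar> \<le> 3 * R * K / \<rho>" by simp
      then have "\<bar>i'\<bar> \<le> m" unfolding m_def by linarith
      then show ?thesis by auto
    qed
    note fi = frenet_point_inner[of c "\<rho> / K" "\<rho> / K" "R / K" i j k, folded P_def]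
    have "i \<in> {-m..m}" "j \<in> {-m..m}" "k \<in> {-m..m}"
      using order_trans[OF abs_inner_frenet_le(1)[of "P c i j k" c] n] order_trans[OF abs_inner_frenet_le(2)[of "P c i j k" c] n]
        order_trans[OF abs_inner_frenet_le(3)[of "P c i j k" c] n] \<rho>(2)
      unfolding fi by (blast intro: bd order_refl)+
    then show "T \<in> (\<Union>c\<in>partition_points R. \<Union>i\<in>{-m..m}. \<Union>j\<in>{-m..m}. \<Union>k\<in>{-m..m}. {T \<in> tubes_of \<T> dir c. P c i j k \<in> T})"
    proof -
      have "T \<in> {T \<in> tubes_of \<T> dir c. P c i j k \<in> T}" using T P by (simp add: tubes_of_def c_def)
      then show ?thesis using c(1) \<open>i \<in> {-m..m}\<close> \<open>j \<in> {-m..m}\<close> \<open>k \<in> {-m..m}\<close> by blast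
    qed
  qed
  moreover have "finite {T \<in> tubes_of \<T> dir c. x \<in> T}" if "c \<in> partition_points R" for c x
    using sep that by (auto simp: separated_vinogradov_tubes_def bounded_overlap_def)
  ultimately show ?thesis
    using finite_partition_points[OF R] by (elim finite_subset) (intro finite_UN_I; simp)
qed

text \<open>Each tube is put in a plate and each plate at a grid point. The index \<open>i\<close>
  across the plate determines \<open>ucoord\<close> up to \<open>O(1)\<close>; the two other indices
  take boundedly many values.\<close>

lemma plate_sum_le:
  fixes \<A> :: "(real^3) set set" and y :: "(real^3) set \<Rightarrow> real^3"
  assumes K: "K \<ge> 1" and R: "R \<ge> 1" and c: "0 \<le> c" "c \<le> 1" and N: "N \<ge> 0" and fin: "finite \<A>"
    and y: "\<And>T. T \<in> \<A> \<Longrightarrow> y T \<in> T \<inter> big_cube R"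
    and S: "\<And>S. S \<in> \<S> \<Longrightarrow> plate K R c S" "bounded_overlap K \<S>"
    and TS: "\<And>T. T \<in> \<A> \<Longrightarrow> \<exists>S\<in>\<S>. T \<subseteq> S"
    and SN: "\<And>S. S \<in> \<S> \<Longrightarrow> real (card {T \<in> \<A>. T \<subseteq> S}) \<le> N"
    and l: "l \<ge> 1"
  shows "(\<Sum>T\<in>\<A>. 1 / (1 + ((ucoord c ((1 / R powr (2/3)) *\<^sub>R y T) - \<mu>) / l)\<^sup>2)) \<le> 1944 * pi * K^8 * N * l"
proof -
  define \<rho> where "\<rho> = R powr (2/3)"
  note \<rho> = powr_two_thirds(1,2)[OF R, folded \<rho>_def]
  have R0: "R > 0" using R by simp
  define P where "P i j k = frenet_point c (\<rho> / K) (R / K) (R / K) i j k" for i j k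
  \<comment> \<open>The plate contains a point of norm at most \<open>3 * R\<close>, so an index
    along a long side, in units of \<open>R / K\<close>, is at most
    \<open>1/2 + K^2 / 2 + 3 K\<close>.\<close>
  define m where "m = \<lfloor>4 * K\<^sup>2\<rfloor>"
  have K2: "K \<le> K\<^sup>2" "1 \<le> K\<^sup>2" using K by (simp_all add: self_le_power one_le_power)
  have "\<exists>i j k S. S \<in> \<S> \<and> T \<subseteq> S \<and> P i j k \<in> S \<and> j \<in> {-m..m} \<and> k \<in> {-m..m} \<and>
      \<bar>of_int i / K - (y T \<bullet> tangent c) / \<rho>\<bar> \<le> K" if T: "T \<in> \<A>" for T
  proof -
    obtain S where S1: "S \<in> \<S>" "T \<subseteq> S" using TS[OF T] by auto
    obtain p i j k where p: "S \<subseteq> frenet_box c p (K * \<rho>) (K * R) (K * R)" "P i j k \<in> S"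
      and g: "\<bar>of_int i * (\<rho> / K) - p \<bullet> tangent c\<bar> \<le> \<rho> / K / 2"
        "\<bar>of_int j * (R / K) - p \<bullet> normal c\<bar> \<le> R / K / 2"
        "\<bar>of_int k * (R / K) - p \<bullet> binormal c\<bar> \<le> R / K / 2"
      unfolding P_def
      by (rule essentially_frenet_box_grid[OF S(1)[OF S1(1), unfolded plate_def, folded \<rho>_def] K \<rho>(1) R0 R0]) blast
    have "y T \<in> frenet_box c p (K * \<rho>) (K * R) (K * R)" using y[OF T] S1(2) p(1) by auto
    then have b: "\<bar>y T \<bullet> tangent c - p \<bullet> tangent c\<bar> \<le> K * \<rho> / 2" "\<bar>y T \<bullet> normal c - p \<bullet> normal c\<bar> \<le> K * R / 2"
      "\<bar>y T \<bullet> binormal c - p \<bullet> binormal c\<bar> \<le> K * R / 2"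
      unfolding frenet_box_def by (simp_all add: inner_diff_left)
    have n: "norm (y T) \<le> 3 * R" using y[OF T] by (intro norm_big_cube) auto
    have bd: "j' \<in> {-m..m}" if "\<bar>of_int j' * (R / K) - a\<bar> \<le> R / K / 2" "\<bar>e - a\<bar> \<le> K * R / 2" "\<bar>e\<bar> \<le> 3 * R" for j' a e
    proof -
      have "\<bar>of_int j' * (R / K)\<bar> \<le> R / K / 2 + K * R / 2 + 3 * R" using that by linarith
      then have "\<bar>of_int j'\<bar> * R / K \<le> R / K / 2 + K * R / 2 + 3 * R" using R K by (simp add: abs_mult)
      from mult_right_mono[OF this, of "K / R"]
      have "\<bar>of_int j'\<bar> \<le> (R / K / 2 + K * R / 2 + 3 * R) * (K / R)" using R K by simp
      also have "\<dots> = 1/2 + K\<^sup>2 / 2 + 3 * K" using R K by (simp add: field_simps power2_eq_square)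
      also have "\<dots> \<le> 4 * K\<^sup>2" using K2 by linarith
      finally have "of_int \<bar>j'\<bar> \<le> 4 * K\<^sup>2" by simp
      then have "\<bar>j'\<bar> \<le> m" unfolding m_def by linarith
      then show ?thesis by auto
    qed
    have jk: "j \<in> {-m..m}" "k \<in> {-m..m}"
      using bd[OF g(2) b(2)] bd[OF g(3) b(3)] abs_inner_frenet_le[of "y T" c] n by linarith+
    have K1: "\<rho> / K \<le> K * \<rho>"
    proof -
      have "\<rho> / K \<le> \<rho>" using K \<rho> by (simp add: divide_le_eq mult_left_le mult_le_cancel_left1)
      also have "\<dots> \<le> K * \<rho>" using K \<rho> by simp
      finally show ?thesis .
    qed
    have tri: "\<bar>a - e\<bar> \<le> u" if "\<bar>a - f\<bar> \<le> s / 2" "\<bar>e - f\<bar> \<le> u / 2" "s \<le> u" for a e f s u :: real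
      using that by linarith
    have "of_int i / K - (y T \<bullet> tangent c) / \<rho> = (of_int i * (\<rho> / K) - y T \<bullet> tangent c) / \<rho>"
      using \<rho> by (simp add: diff_divide_distrib)
    then have "\<bar>of_int i / K - (y T \<bullet> tangent c) / \<rho>\<bar> = \<bar>of_int i * (\<rho> / K) - y T \<bullet> tangent c\<bar> / \<rho>"
      using \<rho> by simp
    also have "\<dots> \<le> (K * \<rho>) / \<rho>" using tri[OF g(1) b(1) K1] \<rho> by (intro divide_right_mono) simp_all
    finally have "\<bar>of_int i / K - (y T \<bullet> tangent c) / \<rho>\<bar> \<le> K" using \<rho> by simp
    then show ?thesis using S1 p(2) jk by blast
  qed
  then obtain I J L F where F: "\<And>T. T \<in> \<A> \<Longrightarrow> F T \<in> \<S> \<and> T \<subseteq> F T \<and> P (I T) (J T) (L T) \<in> F T \<and>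
      J T \<in> {-m..m} \<and> L T \<in> {-m..m} \<and> \<bar>of_int (I T) / K - (y T \<bullet> tangent c) / \<rho>\<bar> \<le> K"
    by metis
  \<comment> \<open>At most \<open>9 K^2\<close> values for each long index, at most
    \<open>K\<close> plates through a grid point, at most \<open>N\<close> tubes in a plate.\<close>
  have fib: "real (card {T \<in> \<A>. I T = i}) \<le> 81 * K^5 * N" for i
  proof -
    define G where "G j k = {S \<in> \<S>. P i j k \<in> S}" for j k
    have G: "finite (G j k)" "real (card (G j k)) \<le> K" for j k
      using S(2) by (auto simp: G_def bounded_overlap_def)
    define M where "M = {-m..m}"
    have cM: "real (card M) \<le> 9 * K\<^sup>2"
    proof -
      have "m \<ge> 0" using K2 by (simp add: m_def)
      then have "real (card M) = 2 * of_int m + 1" by (simp add: M_def)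
      also have "of_int m \<le> 4 * K\<^sup>2" by (simp add: m_def)
      finally show ?thesis using K2 by linarith
    qed
    have "{T \<in> \<A>. I T = i} \<subseteq> (\<Union>j\<in>M. \<Union>k\<in>M. \<Union>S\<in>G j k. {T \<in> \<A>. T \<subseteq> S})"
      using F by (fastforce simp: G_def M_def)
    then have "card {T \<in> \<A>. I T = i} \<le> card (\<Union>j\<in>M. \<Union>k\<in>M. \<Union>S\<in>G j k. {T \<in> \<A>. T \<subseteq> S})"
      using fin by (intro card_mono) (auto intro: finite_subset)
    also have "\<dots> \<le> (\<Sum>j\<in>M. \<Sum>k\<in>M. \<Sum>S\<in>G j k. card {T \<in> \<A>. T \<subseteq> S})"
      using G(1) by (intro order_trans[OF card_UN_le] sum_mono order_refl) (auto simp: M_def)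
    finally have "real (card {T \<in> \<A>. I T = i}) \<le> (\<Sum>j\<in>M. \<Sum>k\<in>M. \<Sum>S\<in>G j k. real (card {T \<in> \<A>. T \<subseteq> S}))"
      by (simp flip: of_nat_sum)
    also have "\<dots> \<le> (\<Sum>j\<in>M. \<Sum>k\<in>M. \<Sum>S\<in>G j k. N)"
      by (intro sum_mono SN) (simp add: G_def)
    also have "\<dots> \<le> (\<Sum>j\<in>M. \<Sum>k\<in>M. K * N)"
      using G(2) N by (intro sum_mono) (simp add: mult_right_mono)
    also have "\<dots> = real (card M) * real (card M) * (K * N)" by simp
    also have "\<dots> \<le> (9 * K\<^sup>2) * (9 * K\<^sup>2) * (K * N)"
      using cM K N by (intro mult_right_mono mult_mono) auto
    also have "\<dots> = 81 * K^5 * N" by (simp add: eval_nat_numeral)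
    finally show ?thesis .
  qed
  define g where "g = norm (velocity c)"
  have g: "g \<ge> 1" using velocity_pos by (simp add: g_def)
  \<comment> \<open>\<open>I T\<close> is about \<open>K\<close> times the rescaled tangential
    coordinate, and \<open>ucoord\<close> is \<open>g\<close> times that coordinate.\<close>
  define \<mu>' where "\<mu>' = K * \<mu> / g"
  have "(\<Sum>T\<in>\<A>. 1 / (1 + ((ucoord c ((1 / \<rho>) *\<^sub>R y T) - \<mu>) / l)\<^sup>2)) \<le>
      (\<Sum>T\<in>\<A>. 3 * K\<^sup>2 * (1 / (1 + ((of_int (I T) - \<mu>') / (K * l))\<^sup>2)))"
  proof (rule sum_mono)
    fix T assume T: "T \<in> \<A>"
    define z where "z = (ucoord c ((1 / \<rho>) *\<^sub>R y T) - \<mu>) / l"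
    define e where "e = of_int (I T) / K - (y T \<bullet> tangent c) / \<rho>"
    have e: "\<bar>e\<bar> \<le> K" using F[OF T] by (simp add: e_def)
    define v where "v = (of_int (I T) - \<mu>') / (K * l)"
    have "v = z / g + e / l"
      using g l K \<rho> by (simp add: v_def z_def e_def \<mu>'_def ucoord_tangent g_def[symmetric] field_simps)
    moreover have "\<bar>z / g\<bar> \<le> \<bar>z\<bar>" using g by (simp add: divide_le_eq mult_le_cancel_left1)
    moreover have "\<bar>e / l\<bar> \<le> K" using e l by (simp add: divide_le_eq) (smt (verit) mult_le_cancel_left1 K)
    ultimately have "\<bar>v\<bar> \<le> \<bar>z\<bar> + K" by linarith
    then have "v\<^sup>2 \<le> (\<bar>z\<bar> + K)\<^sup>2" using K by (simp add: abs_le_square_iff[symmetric])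
    also have "\<dots> \<le> 2 * z\<^sup>2 + 2 * K\<^sup>2"
      using zero_le_power2[of "\<bar>z\<bar> - K"] by (simp add: power2_sum power2_diff)
    finally have v: "1 + v\<^sup>2 \<le> 3 * K\<^sup>2 * (1 + z\<^sup>2)"
      using K2 mult_right_mono[OF K2(2), of "z\<^sup>2"] by (simp add: distrib_left) (use zero_le_power2[of z] in linarith)
    have "0 < 1 + v\<^sup>2" "0 < 1 + z\<^sup>2" by (simp_all add: add_pos_nonneg)
    then have "1 / (1 + z\<^sup>2) \<le> 3 * K\<^sup>2 * (1 / (1 + v\<^sup>2))" using v by (simp add: field_simps)
    then show "1 / (1 + ((ucoord c ((1 / \<rho>) *\<^sub>R y T) - \<mu>) / l)\<^sup>2) \<le> 3 * K\<^sup>2 * (1 / (1 + ((of_int (I T) - \<mu>') / (K * l))\<^sup>2))"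
      unfolding z_def v_def .
  qed
  also have "\<dots> = 3 * K\<^sup>2 * (\<Sum>T\<in>\<A>. 1 / (1 + ((of_int (I T) - \<mu>') / (K * l))\<^sup>2))"
    by (rule sum_distrib_left[symmetric])
  also have "\<dots> \<le> 3 * K\<^sup>2 * ((81 * K^5 * N) * (8 * pi * (K * l)))"
  proof (rule mult_left_mono)
    have "(\<Sum>T\<in>\<A>. 1 / (1 + ((of_int (I T) - \<mu>') / (K * l))\<^sup>2)) \<le>
      (81 * K^5 * N) * (\<Sum>i\<in>I ` \<A>. 1 / (1 + ((of_int i - \<mu>') / (K * l))\<^sup>2))"
      by (rule sum_fibers_le[OF fin fib]) simp
    also have "\<dots> \<le> (81 * K^5 * N) * (8 * pi * (K * l))"
    proof (rule mult_left_mono)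
      show "(\<Sum>i\<in>I ` \<A>. 1 / (1 + ((of_int i - \<mu>') / (K * l))\<^sup>2)) \<le> 8 * pi * (K * l)"
        using fin K l mult_mono[of 1 K 1 l] by (intro sum_inverse_square_int_le) auto
    qed (use K N in simp)
    finally show "(\<Sum>T\<in>\<A>. 1 / (1 + ((of_int (I T) - \<mu>') / (K * l))\<^sup>2)) \<le> (81 * K^5 * N) * (8 * pi * (K * l))" .
  qed simp
  also have "\<dots> = 1944 * pi * K^8 * N * l" by (simp add: eval_nat_numeral)
  finally show ?thesis by (simp add: \<rho>_def)
qed

section \<open>Disjoint cubes and separated points\<close>

lemma cube3_ball:
  assumes "cube3 s q"
  obtains z where "ball z (s / 2) \<subseteq> q" "q \<subseteq> cball z (2 * s)"
proof -
  obtain p and f :: "real^3 \<Rightarrow> real^3" where f: "orthogonal_transformation f" "s > 0" "(\<lambda>x. p + f x) ` box 0 (s *\<^sub>R 1) \<subseteq> q"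
    "q \<subseteq> (\<lambda>x. p + f x) ` cbox 0 (s *\<^sub>R 1)"
    using assms unfolding cube3_def by blast
  define h where "h = (s / 2) *\<^sub>R (1 :: real^3)"
  have lin: "f (a + b) = f a + f b" "f (a - b) = f a - f b" for a b
    using f(1) by (auto simp: orthogonal_transformation_linear linear_add linear_diff)
  have nf: "norm (f a) = norm a" for a using f(1) by (simp add: orthogonal_transformation_norm)
  have "ball (p + f h) (s / 2) \<subseteq> q"
  proof
    fix x assume "x \<in> ball (p + f h) (s / 2)"
    then have x: "norm (x - (p + f h)) < s / 2" by (simp add: dist_norm norm_minus_commute)
    obtain w where w: "f w = x - (p + f h)" using orthogonal_transformation_surj[OF f(1)] by (metis surjD)
    have "\<bar>w $ i\<bar> < s / 2" for i using component_le_norm_cart[of w i] x w nf[of w] by simp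
    then have "h + w \<in> box 0 (s *\<^sub>R 1)"
      unfolding mem_box_cart by (auto simp: h_def abs_less_iff) (smt (verit) field_sum_of_halves)+
    moreover have "x = p + f (h + w)" using w lin by simp
    ultimately show "x \<in> q" using f(3) by blast
  qed
  moreover have "q \<subseteq> cball (p + f h) (2 * s)"
  proof
    fix x assume "x \<in> q"
    then obtain v where v: "x = p + f v" "v \<in> cbox 0 (s *\<^sub>R 1)" using f(4) by auto
    have vi: "\<bar>(v - h) $ i\<bar> \<le> s / 2" for i
    proof -
      have "0 \<le> v $ i" "v $ i \<le> s" using v(2) unfolding mem_box_cart by (auto dest: spec[of _ i])
      moreover have "(v - h) $ i = v $ i - s / 2" by (simp add: h_def)
      ultimately show ?thesis by linarith
    qed
    have "norm (v - h) \<le> (\<Sum>i\<in>UNIV. \<bar>(v - h) $ i\<bar>)" by (rule norm_le_l1_cart)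
    also have "\<dots> \<le> (\<Sum>i\<in>(UNIV::3 set). s / 2)" by (intro sum_mono vi)
    finally have "norm (v - h) \<le> 2 * s" using f(2) by simp
    moreover have "x - (p + f h) = f (v - h)" using v lin by simp
    ultimately have "norm (x - (p + f h)) \<le> 2 * s" using nf by simp
    then show "x \<in> cball (p + f h) (2 * s)" by (simp add: dist_norm norm_minus_commute)
  qed
  ultimately show ?thesis by (rule that)
qed

text \<open>Two points in one cell of side \<open>\<eta> / 4\<close> would be closer than
  \<open>\<eta>\<close>, so cells label points injectively. Moving a point to its cell costs a
  factor 3 per coordinate, and the sum over cells splits into three sums over integers, each at most
  \<open>8 * pi * (4 / \<eta>)\<close>.\<close>

lemma separated_points_sum_le:
  fixes x :: "'b \<Rightarrow> real^3"
  assumes fin: "finite \<Q>" and e: "0 < \<eta>" "\<eta> \<le> 1"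
    and sep: "\<And>q q'. q \<in> \<Q> \<Longrightarrow> q' \<in> \<Q> \<Longrightarrow> q \<noteq> q' \<Longrightarrow> \<eta> \<le> dist (x q) (x q')"
  shows "(\<Sum>q\<in>\<Q>. \<Prod>i\<in>UNIV. 1 / (1 + ((z - x q) $ i)\<^sup>2)) \<le> 27 * (32 * pi / \<eta>) ^ 3"
proof -
  define n where "n i q = \<lfloor>4 * x q $ i / \<eta>\<rfloor>" for i q
  define \<psi> where "\<psi> i k = 1 / (1 + ((of_int k - 4 * z $ i / \<eta>) / (4 / \<eta>))\<^sup>2)" for i and k :: int
  have n: "\<bar>of_int (n i q) * (\<eta> / 4) - x q $ i\<bar> \<le> \<eta> / 4" for i q
  proof -
    have "\<bar>of_int (n i q) - 4 * x q $ i / \<eta>\<bar> \<le> 1" unfolding n_def by linarith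
    then have "\<bar>of_int (n i q) - 4 * x q $ i / \<eta>\<bar> * (\<eta> / 4) \<le> 1 * (\<eta> / 4)" using e by (intro mult_right_mono) auto
    moreover have "\<bar>of_int (n i q) - 4 * x q $ i / \<eta>\<bar> * (\<eta> / 4) = \<bar>(of_int (n i q) - 4 * x q $ i / \<eta>) * (\<eta> / 4)\<bar>"
      using e by (simp add: abs_mult)
    moreover have "(of_int (n i q) - 4 * x q $ i / \<eta>) * (\<eta> / 4) = of_int (n i q) * (\<eta> / 4) - x q $ i"
      using e by (simp add: field_simps)
    ultimately show ?thesis by linarith
  qed
  have inj: "inj_on (\<lambda>q. (n 1 q, n 2 q, n 3 q)) \<Q>"
  proof (rule inj_onI, rule ccontr)
    fix q q' assume q: "q \<in> \<Q>" "q' \<in> \<Q>" "(n 1 q, n 2 q, n 3 q) = (n 1 q', n 2 q', n 3 q')" "q \<noteq> q'"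
    have "\<bar>(x q - x q') $ i\<bar> < \<eta> / 4" if "n i q = n i q'" for i
    proof -
      define y where "y = x q $ i - x q' $ i"
      have "\<bar>4 * x q $ i / \<eta> - 4 * x q' $ i / \<eta>\<bar> < 1" using that unfolding n_def by linarith
      then have "\<bar>4 / \<eta> * y\<bar> < 1" by (simp add: y_def right_diff_distrib)
      then have "4 / \<eta> * \<bar>y\<bar> < 1" using e by (simp add: abs_mult)
      then have "\<bar>y\<bar> < \<eta> / 4" using e by (simp add: field_simps)
      then show ?thesis by (simp add: y_def)
    qed
    from this[of 1] this[of 2] this[of 3] have "(\<Sum>i\<in>UNIV. \<bar>(x q - x q') $ i\<bar>) < \<eta>"
      using q(3) e unfolding sum_3 prod.inject by linarith
    then have "dist (x q) (x q') < \<eta>" using norm_le_l1_cart[of "x q - x q'"] by (simp add: dist_norm)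
    then show False using sep[OF q(1,2,4)] by simp
  qed
  have one: "1 / (1 + ((z - x q) $ i)\<^sup>2) \<le> 3 * \<psi> i (n i q)" for i q
  proof -
    define a where "a = (z - x q) $ i"
    define v where "v = (of_int (n i q) - 4 * z $ i / \<eta>) / (4 / \<eta>)"
    have "v = of_int (n i q) * (\<eta> / 4) - z $ i" using e by (simp add: v_def field_simps)
    moreover have "a = z $ i - x q $ i" by (simp add: a_def)
    ultimately have "\<bar>v\<bar> \<le> \<bar>a\<bar> + 1" using n[of i q] e by linarith
    then have "v\<^sup>2 \<le> (\<bar>a\<bar> + 1)\<^sup>2" by (simp add: abs_le_square_iff[symmetric])
    also have "\<dots> \<le> 2 * a\<^sup>2 + 2" using zero_le_power2[of "\<bar>a\<bar> - 1"] by (simp add: power2_sum power2_diff)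
    finally have "1 + v\<^sup>2 \<le> 3 * (1 + a\<^sup>2)" unfolding distrib_left using zero_le_power2[of a] by linarith
    moreover have "0 < 1 + v\<^sup>2" "0 < 1 + a\<^sup>2" by (simp_all add: add_pos_nonneg)
    ultimately have "1 / (1 + a\<^sup>2) \<le> 3 * (1 / (1 + v\<^sup>2))" by (simp add: field_simps)
    then show ?thesis by (simp add: \<psi>_def a_def v_def)
  qed
  have \<psi>0: "\<psi> i k \<ge> 0" for i k by (simp add: \<psi>_def)
  define H where "H t = (case t of (a, b, c) \<Rightarrow> \<psi> 1 a * (\<psi> 2 b * \<psi> 3 c))" for t
  define A where "A i = n i ` \<Q>" for i
  have fA: "finite (A i)" for i using fin by (simp add: A_def)
  have "(\<Sum>q\<in>\<Q>. \<Prod>i\<in>UNIV. 1 / (1 + ((z - x q) $ i)\<^sup>2)) \<le> (\<Sum>q\<in>\<Q>. 27 * H (n 1 q, n 2 q, n 3 q))"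
  proof (rule sum_mono)
    fix q
    have "(\<Prod>i\<in>UNIV. 1 / (1 + ((z - x q) $ i)\<^sup>2)) \<le> (\<Prod>i\<in>UNIV. 3 * \<psi> i (n i q))"
      by (intro prod_mono conjI one) simp
    also have "\<dots> = 27 * H (n 1 q, n 2 q, n 3 q)"
      unfolding UNIV_3 by (simp add: H_def)
    finally show "(\<Prod>i\<in>UNIV. 1 / (1 + ((z - x q) $ i)\<^sup>2)) \<le> 27 * H (n 1 q, n 2 q, n 3 q)" .
  qed
  also have "\<dots> = 27 * (\<Sum>t\<in>(\<lambda>q. (n 1 q, n 2 q, n 3 q)) ` \<Q>. H t)"
    by (simp add: sum.reindex[OF inj] sum_distrib_left)
  also have "\<dots> \<le> 27 * (\<Sum>t\<in>A 1 \<times> A 2 \<times> A 3. H t)"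
    using fA \<psi>0 by (intro mult_left_mono sum_mono2) (auto simp: A_def H_def)
  also have "(\<Sum>t\<in>A 1 \<times> A 2 \<times> A 3. H t) = (\<Sum>a\<in>A 1. \<Sum>b\<in>A 2. \<Sum>c\<in>A 3. \<psi> 1 a * (\<psi> 2 b * \<psi> 3 c))"
    by (simp add: H_def sum.cartesian_product)
  also have "\<dots> = (\<Sum>a\<in>A 1. \<psi> 1 a) * ((\<Sum>b\<in>A 2. \<psi> 2 b) * (\<Sum>c\<in>A 3. \<psi> 3 c))"
    by (simp only: sum_distrib_left[symmetric] sum_distrib_right[symmetric])
  also have "\<dots> \<le> (32 * pi / \<eta>) * ((32 * pi / \<eta>) * (32 * pi / \<eta>))"
  proof -
    have "(\<Sum>a\<in>A i. \<psi> i a) \<le> 32 * pi / \<eta>" for i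
      using sum_inverse_square_int_le[OF fA, of "4 / \<eta>" "4 * z $ i / \<eta>" i] e by (simp add: \<psi>_def)
    then show ?thesis using \<psi>0 e by (intro mult_mono mult_nonneg_nonneg sum_nonneg) auto
  qed
  finally show ?thesis by (simp add: power3_eq_cube mult.assoc)
qed

section \<open>From tubes, plates and cubes to the incidence bound\<close>

definition packing_const :: "real \<Rightarrow> real" where
  "packing_const K = 1944 * pi * K^8 + 27 * (64 * pi * K) ^ 3"

text \<open>\<open>ucoord\<close> and \<open>vcoord\<close> see only the short sides of the tube.
  The third coordinate can be a multiple of \<open>K * R\<close>, which the factor
  \<open>R powr (-1/3)\<close> brings down to the scale of the cubes. The constant 24 is
  \<open>4 * (3 + 3)\<close> from \<open>vcoord_frenet\<close>.\<close>

lemma tube_meets_cube: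
  assumes K: "K \<ge> 1" and R: "R \<ge> 1" and c: "0 \<le> c" "c \<le> 1"
    and T: "T \<subseteq> frenet_box c p (K * R powr (2/3)) (K * R powr (2/3)) (K * R)"
    and q: "q \<subseteq> cball z (2 * s)" "s \<le> K * R powr (2/3)" and meet: "q \<inter> T \<noteq> {}"
  shows "\<bar>ucoord c ((1 / R powr (2/3)) *\<^sub>R z - (1 / R powr (2/3)) *\<^sub>R p)\<bar> \<le> 24 * K"
    "\<bar>vcoord c ((1 / R powr (2/3)) *\<^sub>R z - (1 / R powr (2/3)) *\<^sub>R p)\<bar> \<le> 24 * K"
    "\<bar>R powr (-1/3) * ((1 / R powr (2/3)) *\<^sub>R z - (1 / R powr (2/3)) *\<^sub>R p) $ 3\<bar> \<le> 24 * K"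
proof -
  define \<rho> where "\<rho> = R powr (2/3)"
  define d where "d = R powr (-1/3)"
  note \<rho> = powr_two_thirds[OF R, folded \<rho>_def d_def]
  obtain a where a: "a \<in> q" "a \<in> T" using meet by auto
  have e: "norm (z - a) \<le> 2 * (K * \<rho>)" using a(1) q by (auto simp: dist_norm \<rho>_def)
  have f: "\<bar>(a - p) \<bullet> tangent c\<bar> \<le> K * \<rho> / 2" "\<bar>(a - p) \<bullet> normal c\<bar> \<le> K * \<rho> / 2" "\<bar>(a - p) \<bullet> binormal c\<bar> \<le> K * R / 2"
    using a(2) T by (auto simp: frenet_box_def \<rho>_def)
  define w where "w = z - p"
  have w: "w = (z - a) + (a - p)" by (simp add: w_def)
  have wt: "\<bar>w \<bullet> tangent c\<bar> \<le> 3 * (K * \<rho>)" "\<bar>w \<bullet> normal c\<bar> \<le> 3 * (K * \<rho>)"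
    unfolding w inner_add_left using abs_inner_frenet_le[of "z - a" c] e f K \<rho>(1) by linarith+
  have K\<rho>: "K * \<rho> \<le> K * R" "0 \<le> K * \<rho>" using K \<rho> by simp_all
  have "norm w \<le> norm (z - a) + norm (a - p)" unfolding w by (rule norm_triangle_ineq)
  also have "norm (a - p) \<le> K * \<rho> / 2 + K * \<rho> / 2 + K * R / 2"
    using norm_le_frenet[of "a - p" c] f by linarith
  finally have "norm w \<le> 4 * (K * R)" using e K\<rho> by linarith
  then have w3: "\<bar>w $ 3\<bar> \<le> 4 * (K * R)" using component_le_norm_cart[of w 3] by linarith
  have sc: "(1 / \<rho>) *\<^sub>R z - (1 / \<rho>) *\<^sub>R p = (1 / \<rho>) *\<^sub>R w" by (simp add: w_def scaleR_diff_right)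
  have us: "ucoord c ((1 / \<rho>) *\<^sub>R w) = ucoord c w / \<rho>" "vcoord c ((1 / \<rho>) *\<^sub>R w) = vcoord c w / \<rho>"
    by (simp_all add: ucoord_def vcoord_def add_divide_distrib)
  have "\<bar>ucoord c w\<bar> = norm (velocity c) * \<bar>w \<bullet> tangent c\<bar>" by (simp add: ucoord_tangent abs_mult)
  also have "\<dots> \<le> 4 * (3 * (K * \<rho>))" using velocity_le[OF c] wt(1) by (intro mult_mono) auto
  finally have "\<bar>ucoord c w\<bar> \<le> 24 * K * \<rho>" using K\<rho> by linarith
  then show "\<bar>ucoord c ((1 / R powr (2/3)) *\<^sub>R z - (1 / R powr (2/3)) *\<^sub>R p)\<bar> \<le> 24 * K"
    unfolding \<rho>_def[symmetric] sc us using \<rho>(1) by (simp add: divide_le_eq)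
  have "\<bar>vcoord c w\<bar> \<le> 24 * K * \<rho>" using vcoord_frenet[OF c, of w] wt unfolding distrib_left by linarith
  then show "\<bar>vcoord c ((1 / R powr (2/3)) *\<^sub>R z - (1 / R powr (2/3)) *\<^sub>R p)\<bar> \<le> 24 * K"
    unfolding \<rho>_def[symmetric] sc us using \<rho>(1) by (simp add: divide_le_eq)
  have "d * \<bar>w $ 3\<bar> \<le> d * (4 * (K * R))" using w3 \<rho>(3) by (intro mult_left_mono) auto
  also have "\<dots> = 4 * K * (d * R)" by simp
  also have "\<dots> \<le> 24 * K * \<rho>" unfolding \<rho>(5) using K\<rho> by linarith
  finally have "d * \<bar>w $ 3\<bar> / \<rho> \<le> 24 * K" using \<rho>(1) by (simp add: divide_le_eq)
  then show "\<bar>R powr (-1/3) * ((1 / R powr (2/3)) *\<^sub>R z - (1 / R powr (2/3)) *\<^sub>R p) $ 3\<bar> \<le> 24 * K"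
    unfolding \<rho>_def[symmetric] d_def[symmetric] sc using \<rho>(1,3) by (simp add: abs_mult)
qed

lemma rich_cubes_card_le:
  assumes K: "K \<ge> 1" and R: "R \<ge> 1" and N: "N \<ge> 0" and r: "r > 0"
    and sep: "separated_vinogradov_tubes K R \<T> dir" and S1: "S1 K R N \<T> dir"
    and rich: "rich_cubes K R r \<T> \<Q>" and fQ: "finite \<Q>" and J: "R \<le> 2^J"
  shows "real (card \<Q>) \<le> incidence_const (24 * K) (packing_const K) * (real (J + 1))\<^sup>2 *
    (real (card \<T>) * N * R powr (1/3) / r\<^sup>2)"
proof -
  define \<rho> where "\<rho> = R powr (2/3)"
  define d where "d = R powr (-1/3)"
  note \<rho> = powr_two_thirds[OF R, folded \<rho>_def d_def]
  have fT: "finite \<T>" by (rule finite_separated_tubes[OF K R sep])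
  have R0: "R > 0" using R by simp
  have tube: "dir T \<in> partition_points R" "vinogradov_tube K R (dir T) T" "T \<subseteq> big_cube R" if "T \<in> \<T>" for T
    using sep that by (auto simp: separated_vinogradov_tubes_def)
  have "\<exists>p. p \<in> T \<and> T \<subseteq> frenet_box (dir T) p (K * \<rho>) (K * \<rho>) (K * R)" if "T \<in> \<T>" for T
    by (rule essentially_frenet_box_grid[OF tube(2)[OF that, unfolded vinogradov_tube_def, folded \<rho>_def] K \<rho>(1) \<rho>(1) R0]) blast
  then obtain p where p: "\<And>T. T \<in> \<T> \<Longrightarrow> p T \<in> T \<and> T \<subseteq> frenet_box (dir T) (p T) (K * \<rho>) (K * \<rho>) (K * R)" by metis
  have "\<exists>k. dir T = real k * d" if "T \<in> \<T>" for T using tube(1)[OF that] by (auto simp: partition_points_def d_def)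
  then obtain n where n: "\<And>T. T \<in> \<T> \<Longrightarrow> dir T = real (n T) * d" by metis
  have dir: "0 \<le> dir T" "dir T < 1" if "T \<in> \<T>" for T using tube(1)[OF that] by (auto simp: partition_points_def)
  have cubes: "\<exists>s. \<rho> / K \<le> s \<and> s \<le> K * \<rho> \<and> cube3 s q" if "q \<in> \<Q>" for q
    using rich[unfolded rich_cubes_def, THEN conjunct2, THEN bspec, OF that] unfolding \<rho>_def by (rule conjunct2)
  define P where "P q s z \<longleftrightarrow> \<rho> / K \<le> s \<and> s \<le> K * \<rho> \<and> ball z (s / 2) \<subseteq> q \<and> q \<subseteq> cball z (2 * s)"
    for q :: "(real^3) set" and s z
  have "\<exists>s z. P q s z" if q: "q \<in> \<Q>" for q
  proof -
    obtain s where s: "\<rho> / K \<le> s" "s \<le> K * \<rho>" "cube3 s q"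
      using cubes[OF q] by blast
    show ?thesis unfolding P_def by (rule cube3_ball[OF s(3)]) (use s in blast)
  qed
  then obtain s z where "\<And>q. q \<in> \<Q> \<Longrightarrow> P q (s q) (z q)" by metis
  then have z: "\<And>q. q \<in> \<Q> \<Longrightarrow> \<rho> / K \<le> s q \<and> s q \<le> K * \<rho> \<and> ball (z q) (s q / 2) \<subseteq> q \<and> q \<subseteq> cball (z q) (2 * s q)"
    unfolding P_def by blast
  define y where "y T = (1 / \<rho>) *\<^sub>R p T" for T
  define x where "x q = (1 / \<rho>) *\<^sub>R z q" for q
  \<comment> \<open>One constant for both packing hypotheses of \<open>incidence_bound\<close>: its
    first summand serves the plates, the second the centres of the cubes, which after rescaling are
    \<open>1 / (2 K)\<close>-separated.\<close>
  define B where "B = packing_const K"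
  have B: "1944 * pi * K^8 \<le> B" "27 * (64 * pi * K) ^ 3 \<le> B" "B > 0"
    using K by (simp_all add: B_def packing_const_def add_pos_nonneg)
  have "real (card \<Q>) \<le> incidence_const (24 * K) B * (real (J + 1))\<^sup>2 * (real (card \<T>) * N / (d * r\<^sup>2))"
  proof (rule incidence_bound[where y = y and x = x and n = n])
    show "n T < 2^J" if "T \<in> \<T>" for T
    proof -
      have "real (n T) * d < 1" using dir[OF that] n[OF that] by simp
      then have "real (n T) < R powr (1/3)" using \<rho>(3) unfolding \<rho>(6) by (simp add: pos_less_divide_eq)
      also have "\<dots> \<le> R" using powr_mono[of "1/3" 1 R] R by simp
      also have "\<dots> \<le> real (2^J)" using J by simp
      finally show ?thesis by (simp only: of_nat_less_iff)
    qed
    show "real (n T) * d \<le> 1" if "T \<in> \<T>" for T using dir[OF that] n[OF that] by simp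
    show "(\<Sum>T | T \<in> \<T> \<and> n T = k. 1 / (1 + ((ucoord (real k * d) (y T) - \<mu>) / l)\<^sup>2)) \<le> B * N * l"
      if l: "1 \<le> l" for k l \<mu>
    proof (cases "\<exists>T\<in>\<T>. n T = k")
      case True
      define c where "c = real k * d"
      have c: "c \<in> partition_points R" "0 \<le> c" "c \<le> 1"
      proof -
        obtain T where T: "T \<in> \<T>" "n T = k" using True by blast
        then have "dir T = c" using n by (simp add: c_def)
        then show "c \<in> partition_points R" "0 \<le> c" "c \<le> 1" using tube(1)[OF T(1)] dir[OF T(1)] by simp_all
      qed
      have A: "{T. T \<in> \<T> \<and> n T = k} = tubes_of \<T> dir c"
        using n \<rho>(3) by (auto simp: tubes_of_def c_def)
      obtain \<S> where S': "(\<forall>S\<in>\<S>. plate K R c S) \<and> bounded_overlap K \<S> \<and> big_cube R \<subseteq> \<Union>\<S> \<and>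
        (\<forall>T\<in>tubes_of \<T> dir c. \<exists>S\<in>\<S>. T \<subseteq> S) \<and>
        (\<forall>S\<in>\<S>. real (card {T \<in> tubes_of \<T> dir c. T \<subseteq> S}) \<le> N)"
        using S1[unfolded S1_def, THEN bspec, OF c(1)] ..
      then have S: "\<And>S. S \<in> \<S> \<Longrightarrow> plate K R c S" "bounded_overlap K \<S>"
        "\<And>T. T \<in> tubes_of \<T> dir c \<Longrightarrow> \<exists>S\<in>\<S>. T \<subseteq> S"
        "\<And>S. S \<in> \<S> \<Longrightarrow> real (card {T \<in> tubes_of \<T> dir c. T \<subseteq> S}) \<le> N"
        by simp_all
      have "(\<Sum>T\<in>tubes_of \<T> dir c. 1 / (1 + ((ucoord c ((1 / R powr (2/3)) *\<^sub>R p T) - \<mu>) / l)\<^sup>2)) \<le> 1944 * pi * K^8 * N * l"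
      proof (rule plate_sum_le[OF K R c(2,3) N _ _ S l])
        show "finite (tubes_of \<T> dir c)" using fT by (simp add: tubes_of_def)
        show "p T \<in> T \<inter> big_cube R" if "T \<in> tubes_of \<T> dir c" for T
          using that p[of T] tube(3)[of T] by (auto simp: tubes_of_def)
      qed
      also have "\<dots> \<le> B * N * l" using B N l by (intro mult_right_mono) auto
      finally show ?thesis unfolding A c_def[symmetric] y_def \<rho>_def .
    next
      \<comment> \<open>\<open>S1\<close> provides plates for partition points only. An index of no
        tube need not give one, but then the sum is empty.\<close>
      case False
      then have e: "{T. T \<in> \<T> \<and> n T = k} = {}" by auto
      show ?thesis unfolding e using B N l by simp
    qed
    show "(\<Sum>q'\<in>\<Q>. \<Prod>i\<in>UNIV. 1 / (1 + ((x q - x q') $ i)\<^sup>2)) \<le> B" if "q \<in> \<Q>" for q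
    proof -
      have "(\<Sum>q'\<in>\<Q>. \<Prod>i\<in>UNIV. 1 / (1 + ((x q - x q') $ i)\<^sup>2)) \<le> 27 * (32 * pi / (1 / (2 * K))) ^ 3"
      proof (rule separated_points_sum_le[OF fQ])
        fix a b assume ab: "a \<in> \<Q>" "b \<in> \<Q>" "a \<noteq> b"
        have "disjnt a b" using rich ab by (auto simp: rich_cubes_def pairwise_def)
        have "\<rho> / K > 0" using \<rho>(1) K by simp
        then have "z b \<in> b" using z[OF ab(2)] by force
        then have "z b \<notin> ball (z a) (s a / 2)" using z[OF ab(1)] \<open>disjnt a b\<close> by (auto simp: disjnt_iff)
        \<comment> \<open>The cube \<open>a\<close> contains the ball of radius
          \<open>s a / 2\<close> about its centre, and the centre of \<open>b\<close> lies in the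
          disjoint cube \<open>b\<close>.\<close>
        then have "\<rho> / K / 2 \<le> dist (z a) (z b)" using z[OF ab(1)] by simp
        then have "\<rho> / K / 2 / \<rho> \<le> dist (z a) (z b) / \<rho>" using \<rho>(1) by (intro divide_right_mono) auto
        moreover have "\<rho> / K / 2 / \<rho> = 1 / (2 * K)" using \<rho>(1) by simp
        moreover have "dist (x a) (x b) = dist (z a) (z b) / \<rho>"
          using \<rho>(1) by (simp add: x_def dist_norm flip: scaleR_diff_right)
        ultimately show "1 / (2 * K) \<le> dist (x a) (x b)" by simp
      qed (use K in auto)
      also have "\<dots> = 27 * (64 * pi * K) ^ 3" by (simp add: power_mult_distrib)
      finally show ?thesis using B by linarith
    qed
    show "r \<le> real (card {T \<in> \<T>. \<bar>ucoord (real (n T) * d) (x q - y T)\<bar> \<le> 24 * K \<and>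
        \<bar>vcoord (real (n T) * d) (x q - y T)\<bar> \<le> 24 * K \<and> \<bar>d * (x q - y T) $ 3\<bar> \<le> 24 * K})" if q: "q \<in> \<Q>" for q
    proof -
      have "r \<le> real (card {T \<in> \<T>. q \<inter> T \<noteq> {}})"
        using rich q by (auto simp: rich_cubes_def rich_def)
      also have "card {T \<in> \<T>. q \<inter> T \<noteq> {}} \<le> card {T \<in> \<T>. \<bar>ucoord (real (n T) * d) (x q - y T)\<bar> \<le> 24 * K \<and>
        \<bar>vcoord (real (n T) * d) (x q - y T)\<bar> \<le> 24 * K \<and> \<bar>d * (x q - y T) $ 3\<bar> \<le> 24 * K}"
      proof (rule card_mono)
        show "{T \<in> \<T>. q \<inter> T \<noteq> {}} \<subseteq> {T \<in> \<T>. \<bar>ucoord (real (n T) * d) (x q - y T)\<bar> \<le> 24 * K \<and>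
          \<bar>vcoord (real (n T) * d) (x q - y T)\<bar> \<le> 24 * K \<and> \<bar>d * (x q - y T) $ 3\<bar> \<le> 24 * K}"
        proof
          fix T assume "T \<in> {T \<in> \<T>. q \<inter> T \<noteq> {}}"
          then have T: "T \<in> \<T>" "q \<inter> T \<noteq> {}" by auto
          have d1: "dir T \<le> 1" using dir[OF T(1)] by simp
          note m = tube_meets_cube[OF K R dir(1)[OF T(1)] d1 _ _ _ T(2), of "p T" "z q" "s q", folded \<rho>_def d_def x_def y_def]
          show "T \<in> {T \<in> \<T>. \<bar>ucoord (real (n T) * d) (x q - y T)\<bar> \<le> 24 * K \<and>
            \<bar>vcoord (real (n T) * d) (x q - y T)\<bar> \<le> 24 * K \<and> \<bar>d * (x q - y T) $ 3\<bar> \<le> 24 * K}"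
            using m p[OF T(1)] z[OF q] T(1) n[OF T(1)] by simp
        qed
      qed (use fT in simp)
      finally show ?thesis by simp
    qed
  qed (use fT fQ \<rho> B N r in auto)
  also have "real (card \<T>) * N / (d * r\<^sup>2) = real (card \<T>) * N * R powr (1/3) / r\<^sup>2"
    unfolding \<rho>(6) by simp
  finally show ?thesis by (simp add: B_def)
qed

text \<open>Finiteness of \<open>\<Q>\<close> is part of the claim because \<open>card\<close> is 0
  on infinite sets. It follows from the bound for finite subfamilies, which is the same for all of
  them.\<close>

theorem corollary4p5:
  fixes K :: real
  assumes "K \<ge> 1"
  shows "\<exists>C>0. \<exists>R\<^sub>0\<ge>1. \<forall>R\<ge>R\<^sub>0. \<forall>N\<ge>1. \<forall>\<T> dir.
    separated_vinogradov_tubes K R \<T> dir \<longrightarrow> S1 K R N \<T> dir \<longrightarrow>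
    (\<forall>r\<ge>1. \<forall>\<Q>. rich_cubes K R r \<T> \<Q> \<longrightarrow>
       finite \<Q> \<and>
       real (card \<Q>) \<le> C * ln R powr C * (real (card \<T>) * N * R powr (1/3) / r^2))"
proof -
  define I where "I = incidence_const (24 * K) (packing_const K)"
  have I: "I \<ge> 0" by (simp add: I_def incidence_const_def)
  \<comment> \<open>One \<open>C\<close> serves as factor and as exponent: \<open>16 * I\<close>
    absorbs \<open>(J + 1)^2 <= 16 (ln R)^2\<close>, and \<open>C >= 2\<close> dominates the square
    once \<open>ln R >= 1\<close>, hence the threshold \<open>R >= 3\<close>.\<close>
  define C where "C = 16 * I + 2"
  have C: "C \<ge> 2" "16 * I \<le> C" using I by (simp_all add: C_def)
  have main: "finite \<Q> \<and> real (card \<Q>) \<le> C * ln R powr C * (real (card \<T>) * N * R powr (1/3) / r^2)"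
    if R: "R \<ge> 3" and N: "N \<ge> 1" and sep: "separated_vinogradov_tubes K R \<T> dir" and S1: "S1 K R N \<T> dir"
      and r: "r \<ge> 1" and rich: "rich_cubes K R r \<T> \<Q>" for R N \<T> dir r \<Q>
  proof -
    define X where "X = C * ln R powr C * (real (card \<T>) * N * R powr (1/3) / r^2)"
    define J where "J = nat \<lceil>log 2 R\<rceil>"
    have ln1: "1 \<le> ln R" using R exp_le by (simp add: ln_ge_iff)
    have log0: "0 \<le> log 2 R" using R by simp
    have J2: "R \<le> 2^J"
    proof -
      have "R = 2 powr (log 2 R)" using R by simp
      also have "\<dots> \<le> 2 powr real J" unfolding J_def by (intro powr_mono) linarith+
      finally show ?thesis by (simp add: powr_realpow)
    qed
    have "real (J + 1) \<le> log 2 R + 2" using log0 unfolding J_def by linarith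
    also have "log 2 R \<le> 2 * ln R"
    proof -
      have "ln R / ln 2 \<le> ln R / (1/2)" using ln1 ln2_ge_two_thirds by (intro divide_left_mono) auto
      then show ?thesis by (simp add: log_def)
    qed
    finally have "real (J + 1) \<le> 4 * ln R" using ln1 by linarith
    then have "(real (J + 1))\<^sup>2 \<le> (4 * ln R)\<^sup>2" by (intro power_mono) auto
    also have "\<dots> = 16 * (ln R powr 2)" using ln1 by (simp add: power_mult_distrib powr_numeral)
    also have "\<dots> \<le> 16 * (ln R powr C)" using ln1 C by (intro mult_left_mono powr_mono) auto
    finally have "I * (real (J + 1))\<^sup>2 \<le> I * (16 * (ln R powr C))" using I by (intro mult_left_mono)
    also have "\<dots> = (16 * I) * ln R powr C" by simp
    also have "\<dots> \<le> C * ln R powr C" using C by (intro mult_right_mono) auto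
    finally have IC: "I * (real (J + 1))\<^sup>2 \<le> C * ln R powr C" .
    have bound: "real (card \<Q>') \<le> X" if "\<Q>' \<subseteq> \<Q>" "finite \<Q>'" for \<Q>'
    proof -
      have "rich_cubes K R r \<T> \<Q>'"
        using rich that(1) unfolding rich_cubes_def by (meson pairwise_subset subsetD)
      then have "real (card \<Q>') \<le> I * (real (J + 1))\<^sup>2 * (real (card \<T>) * N * R powr (1/3) / r\<^sup>2)"
        unfolding I_def using assms R N r J2 that(2) by (intro rich_cubes_card_le[OF _ _ _ _ sep S1]) auto
      also have "\<dots> \<le> X" unfolding X_def using IC N by (intro mult_right_mono) auto
      finally show ?thesis .
    qed
    have "finite \<Q> \<and> card \<Q> \<le> nat \<lfloor>X\<rfloor>"
    proof (rule finite_if_finite_subsets_card_bdd)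
      fix G assume "G \<subseteq> \<Q>" "finite G"
      from bound[OF this] show "card G \<le> nat \<lfloor>X\<rfloor>" by linarith
    qed
    then show ?thesis using bound[of \<Q>] by (simp add: X_def)
  qed
  show ?thesis
  proof (rule exI[of _ C], rule conjI)
    show "C > 0" using C by simp
    show "\<exists>R\<^sub>0\<ge>1. \<forall>R\<ge>R\<^sub>0. \<forall>N\<ge>1. \<forall>\<T> dir.
      separated_vinogradov_tubes K R \<T> dir \<longrightarrow> S1 K R N \<T> dir \<longrightarrow>
      (\<forall>r\<ge>1. \<forall>\<Q>. rich_cubes K R r \<T> \<Q> \<longrightarrow>
       finite \<Q> \<and> real (card \<Q>) \<le> C * ln R powr C * (real (card \<T>) * N * R powr (1/3) / r^2))"
      by (rule exI[of _ 3], intro conjI allI impI main[THEN conjunct1] main[THEN conjunct2]) simp_all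
  qed
qed

end
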